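(* Let $R$ be a ring such that $R_R$ is an injective cogenerator in the category of right $R$-modules. Let $P=(V,W)$ be a left $R$-pairing and equip $V$ with the linear weak topology $V[\mathfrak{T}_{ls}^{r}(W)]$. Then: (1) The closure of every right $R$-submodule $X\subseteq V$ is $\overline{X}=X^{\bot\bot}$. (2) Let $X\subseteq Y\subseteq V$ be right $R$-submodules. Then $X$ is dense in $Y$ if and only if $X^{\bot}=Y^{\bot}$. If $\chi_P:W\to V^{*}$ is injective, then a right $R$-submodule $X\subseteq V$ is dense in $V$ if and only if $X^{\bot}=0$. (3) Let $R$ be a QF ring and let $X\subseteq V$ be an $R$-cofinite right $R$-submodule. Then $X$ is closed if and only if $\mathrm{An}(X)=\chi_P(X^{\bot})$. (4) The class of closed right $R$-submodules of $V$ is $\{K^{\bot}\mid K\subseteq W \text{ an arbitrary left } R\text{-submodule}\}$. (5) If $R$ is a QF ring and $\chi_P:W\to V^{*}$ is injective, then the class of open right $R$-submodules of $V$ is $\{K^{\bot}\mid K\subseteq W \text{ a finitely generated left } R\text{-submodule}\}$.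
   Context: $R$ is an associative, not necessarily commutative ring with $1_R\neq 0_R$; all modules are unitary. For a left $R$-module $W$, ${}^{*}W$ is the right $R$-module of left $R$-linear maps $W\to R$, with $(fr)(w)=f(w)r$; for a right $R$-module $V$, $V^{*}$ is the left $R$-module of right $R$-linear maps $V\to R$, with $(rg)(v)=r\,g(v)$. A left $R$-pairing $P=(V,W)$ consists of a right $R$-module $V$, a left $R$-module $W$ and a right $R$-linear map $\kappa_P:V\to{}^{*}W$; equivalently a left $R$-linear map $\chi_P:W\to V^{*}$, where $\langle v,w\rangle:=\kappa_P(v)(w)=\chi_P(w)(v)$. For $X\subseteq V$ put $X^{\bot}=\{w\in W\mid \langle x,w\rangle=0\ \forall x\in X\}$, and for $K\subseteq W$ put $K^{\bot}=\{v\in V\mid \langle v,k\rangle=0\ \forall k\in K\}$; $X^{\bot\bot}=(X^\bot)^\bot$. For $X\subseteq V$, $\mathrm{An}(X)=\{g\in V^{*}\mid g(X)=0\}$. The linear weak topology $V[\mathfrak{T}_{ls}^{r}(W)]$ is the linear topology on $V$ in which the submodules $F^{\bot}$, $F\subseteq W$ finite, form a basis of neighbourhoods of $0$; thus the closure of a submodule $X\subseteq V$ is $\overline{X}=\bigcap\{X+F^{\bot}\mid F\subseteq W\text{ finite}\}$. A submodule $X\subseteq V$ is $R$-cofinite if $V/X$ is finitely generated. $R$ is a QF ring if $R_R$ (equivalently ${}_RR$) is Noetherian and a cogenerator. *)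

theory Defs
  imports "HOL-Algebra.Module" "HOL-Algebra.AbelCoset" "HOL-Analysis.Abstract_Topology"
begin

section \<open>One-sided modules over a ring that need not be commutative\<close>

text \<open>
  The locale \<^locale>\<open>module\<close> requires a commutative ring, so one-sided modules are introduced here.
  Left modules use the library record for modules and the library notion \<^const>\<open>submodule\<close>
  (which does not mention commutativity). Right modules get a record of their own whose scalar
  multiplication takes the scalar on the right.  In both records the inherited fields \<^const>\<open>mult\<close>
  and \<^const>\<open>one\<close> play no role.
\<close>

record ('a, 'b) rmodule = "'b ring" +
  rsmult :: "['b, 'a] \<Rightarrow> 'b" (infixl \<open>\<cdot>\<index>\<close> 70)

locale left_module = R?: ring R + M?: abelian_group M
  for R :: "('a, 'x) ring_scheme" (structure) and M :: "('a, 'm, 'y) module_scheme" (structure) +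
  assumes smult_closed:
      "\<lbrakk>a \<in> carrier R; x \<in> carrier M\<rbrakk> \<Longrightarrow> a \<odot>\<^bsub>M\<^esub> x \<in> carrier M"
    and smult_l_distr:
      "\<lbrakk>a \<in> carrier R; b \<in> carrier R; x \<in> carrier M\<rbrakk> \<Longrightarrow>
        (a \<oplus> b) \<odot>\<^bsub>M\<^esub> x = a \<odot>\<^bsub>M\<^esub> x \<oplus>\<^bsub>M\<^esub> b \<odot>\<^bsub>M\<^esub> x"
    and smult_r_distr:
      "\<lbrakk>a \<in> carrier R; x \<in> carrier M; y \<in> carrier M\<rbrakk> \<Longrightarrow>
        a \<odot>\<^bsub>M\<^esub> (x \<oplus>\<^bsub>M\<^esub> y) = a \<odot>\<^bsub>M\<^esub> x \<oplus>\<^bsub>M\<^esub> a \<odot>\<^bsub>M\<^esub> y"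
    and smult_assoc:
      "\<lbrakk>a \<in> carrier R; b \<in> carrier R; x \<in> carrier M\<rbrakk> \<Longrightarrow>
        (a \<otimes> b) \<odot>\<^bsub>M\<^esub> x = a \<odot>\<^bsub>M\<^esub> (b \<odot>\<^bsub>M\<^esub> x)"
    and smult_one: "x \<in> carrier M \<Longrightarrow> \<one> \<odot>\<^bsub>M\<^esub> x = x"

locale right_module = R?: ring R + M?: abelian_group M
  for R :: "('a, 'x) ring_scheme" (structure) and M :: "('a, 'm, 'y) rmodule_scheme" (structure) +
  assumes rsmult_closed:
      "\<lbrakk>x \<in> carrier M; a \<in> carrier R\<rbrakk> \<Longrightarrow> x \<cdot>\<^bsub>M\<^esub> a \<in> carrier M"
    and rsmult_r_distr:
      "\<lbrakk>x \<in> carrier M; a \<in> carrier R; b \<in> carrier R\<rbrakk> \<Longrightarrow>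
        x \<cdot>\<^bsub>M\<^esub> (a \<oplus> b) = x \<cdot>\<^bsub>M\<^esub> a \<oplus>\<^bsub>M\<^esub> x \<cdot>\<^bsub>M\<^esub> b"
    and rsmult_l_distr:
      "\<lbrakk>x \<in> carrier M; y \<in> carrier M; a \<in> carrier R\<rbrakk> \<Longrightarrow>
        (x \<oplus>\<^bsub>M\<^esub> y) \<cdot>\<^bsub>M\<^esub> a = x \<cdot>\<^bsub>M\<^esub> a \<oplus>\<^bsub>M\<^esub> y \<cdot>\<^bsub>M\<^esub> a"
    and rsmult_assoc:
      "\<lbrakk>x \<in> carrier M; a \<in> carrier R; b \<in> carrier R\<rbrakk> \<Longrightarrow>
        x \<cdot>\<^bsub>M\<^esub> (a \<otimes> b) = (x \<cdot>\<^bsub>M\<^esub> a) \<cdot>\<^bsub>M\<^esub> b"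
    and rsmult_one: "x \<in> carrier M \<Longrightarrow> x \<cdot>\<^bsub>M\<^esub> \<one> = x"

locale right_submodule = subgroup H "add_monoid M"
  for H and R :: "('a, 'x) ring_scheme" (structure) and M :: "('a, 'm, 'y) rmodule_scheme" (structure) +
  assumes rsmult_closed: "\<lbrakk>x \<in> H; a \<in> carrier R\<rbrakk> \<Longrightarrow> x \<cdot>\<^bsub>M\<^esub> a \<in> H"

definition left_hom ::
    "('a, 'x) ring_scheme \<Rightarrow> ('a, 'm, 'y) module_scheme \<Rightarrow> ('a, 'n, 'z) module_scheme \<Rightarrow> ('m \<Rightarrow> 'n) set"
  where "left_hom R M N = {f \<in> carrier M \<rightarrow> carrier N.
    (\<forall>x\<in>carrier M. \<forall>y\<in>carrier M. f (x \<oplus>\<^bsub>M\<^esub> y) = f x \<oplus>\<^bsub>N\<^esub> f y) \<and>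
    (\<forall>a\<in>carrier R. \<forall>x\<in>carrier M. f (a \<odot>\<^bsub>M\<^esub> x) = a \<odot>\<^bsub>N\<^esub> f x)}"

definition right_hom ::
    "('a, 'x) ring_scheme \<Rightarrow> ('a, 'm, 'y) rmodule_scheme \<Rightarrow> ('a, 'n, 'z) rmodule_scheme \<Rightarrow> ('m \<Rightarrow> 'n) set"
  where "right_hom R M N = {f \<in> carrier M \<rightarrow> carrier N.
    (\<forall>x\<in>carrier M. \<forall>y\<in>carrier M. f (x \<oplus>\<^bsub>M\<^esub> y) = f x \<oplus>\<^bsub>N\<^esub> f y) \<and>
    (\<forall>x\<in>carrier M. \<forall>a\<in>carrier R. f (x \<cdot>\<^bsub>M\<^esub> a) = f x \<cdot>\<^bsub>N\<^esub> a)}"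

definition lreg :: "('a, 'x) ring_scheme \<Rightarrow> ('a, 'a) module"
  where "lreg R = \<lparr>carrier = carrier R, mult = mult R, one = one R,
    zero = zero R, add = add R,
    smult = mult R\<rparr>"

definition rreg :: "('a, 'x) ring_scheme \<Rightarrow> ('a, 'a) rmodule"
  where "rreg R = \<lparr>carrier = carrier R, mult = mult R, one = one R,
    zero = zero R, add = add R,
    rsmult = mult R\<rparr>"

text \<open>
  The duals \<open>\<^sup>*W\<close> and \<open>V\<^sup>*\<close>.  Their elements are extensional functions, so that equality in
  the dual is equality on the module.
\<close>

definition ldual ::
    "('a, 'x) ring_scheme \<Rightarrow> ('a, 'w, 'y) module_scheme \<Rightarrow> ('a, 'w \<Rightarrow> 'a) rmodule"
  where "ldual R W = \<lparr>carrier = left_hom R W (lreg R) \<inter> extensional (carrier W),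
    mult = undefined, one = undefined,
    zero = (\<lambda>w\<in>carrier W. \<zero>\<^bsub>R\<^esub>),
    add = (\<lambda>f g. \<lambda>w\<in>carrier W. f w \<oplus>\<^bsub>R\<^esub> g w),
    rsmult = (\<lambda>f r. \<lambda>w\<in>carrier W. f w \<otimes>\<^bsub>R\<^esub> r)\<rparr>"

definition rdual ::
    "('a, 'x) ring_scheme \<Rightarrow> ('a, 'v, 'y) rmodule_scheme \<Rightarrow> ('a, 'v \<Rightarrow> 'a) module"
  where "rdual R V = \<lparr>carrier = right_hom R V (rreg R) \<inter> extensional (carrier V),
    mult = undefined, one = undefined,
    zero = (\<lambda>v\<in>carrier V. \<zero>\<^bsub>R\<^esub>),
    add = (\<lambda>f g. \<lambda>v\<in>carrier V. f v \<oplus>\<^bsub>R\<^esub> g v),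
    smult = (\<lambda>r g. \<lambda>v\<in>carrier V. r \<otimes>\<^bsub>R\<^esub> g v)\<rparr>"


section \<open>Finiteness conditions\<close>

definition left_span :: "('a, 'x) ring_scheme \<Rightarrow> ('a, 'm, 'y) module_scheme \<Rightarrow> 'm set \<Rightarrow> 'm set"
  where "left_span R M S = \<Inter>{N. submodule N R M \<and> S \<subseteq> N}"

definition right_span :: "('a, 'x) ring_scheme \<Rightarrow> ('a, 'm, 'y) rmodule_scheme \<Rightarrow> 'm set \<Rightarrow> 'm set"
  where "right_span R M S = \<Inter>{N. right_submodule N R M \<and> S \<subseteq> N}"

definition left_fin_gen :: "('a, 'x) ring_scheme \<Rightarrow> ('a, 'm, 'y) module_scheme \<Rightarrow> 'm set \<Rightarrow> bool"
  where "left_fin_gen R M N \<longleftrightarrow> (\<exists>S \<subseteq> carrier M. finite S \<and> N = left_span R M S)"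

definition right_fin_gen :: "('a, 'x) ring_scheme \<Rightarrow> ('a, 'm, 'y) rmodule_scheme \<Rightarrow> 'm set \<Rightarrow> bool"
  where "right_fin_gen R M N \<longleftrightarrow> (\<exists>S \<subseteq> carrier M. finite S \<and> N = right_span R M S)"

definition rquot :: "('a, 'm, 'y) rmodule_scheme \<Rightarrow> 'm set \<Rightarrow> ('a, 'm set) rmodule"
  where "rquot M X = \<lparr>carrier = a_rcosets\<^bsub>M\<^esub> X, mult = undefined, one = undefined,
    zero = X, add = set_add M,
    rsmult = (\<lambda>C r. \<Union>c\<in>C. X +>\<^bsub>M\<^esub> (c \<cdot>\<^bsub>M\<^esub> r))\<rparr>"

definition cofinite_submodule ::
    "('a, 'x) ring_scheme \<Rightarrow> ('a, 'm, 'y) rmodule_scheme \<Rightarrow> 'm set \<Rightarrow> bool"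
  where "cofinite_submodule R M X \<longleftrightarrow>
    right_submodule X R M \<and> right_fin_gen R (rquot M X) (carrier (rquot M X))"

definition right_noetherian :: "('a, 'x) ring_scheme \<Rightarrow> ('a, 'm, 'y) rmodule_scheme \<Rightarrow> bool"
  where "right_noetherian R M \<longleftrightarrow> (\<forall>N. right_submodule N R M \<longrightarrow> right_fin_gen R M N)"


section \<open>Injective modules and cogenerators\<close>

text \<open>
  Injectivity and the cogenerator property quantify over all right modules.  The first argument
  fixes the type that carries the modules quantified over.
\<close>

definition right_injective ::
    "'m itself \<Rightarrow> ('a, 'x) ring_scheme \<Rightarrow> ('a, 'q, 'y) rmodule_scheme \<Rightarrow> bool"
  where "right_injective U R Q \<longleftrightarrow> right_module R Q \<and>
    (\<forall>(A :: ('a, 'm) rmodule) (B :: ('a, 'm) rmodule). \<forall>i \<in> right_hom R A B. \<forall>f \<in> right_hom R A Q.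
      right_module R A \<and> right_module R B \<and> inj_on i (carrier A) \<longrightarrow>
      (\<exists>g \<in> right_hom R B Q. \<forall>x \<in> carrier A. g (i x) = f x))"

definition right_cogenerator ::
    "'m itself \<Rightarrow> ('a, 'x) ring_scheme \<Rightarrow> ('a, 'q, 'y) rmodule_scheme \<Rightarrow> bool"
  where "right_cogenerator U R C \<longleftrightarrow> right_module R C \<and>
    (\<forall>(A :: ('a, 'm) rmodule) (B :: ('a, 'm) rmodule). \<forall>f \<in> right_hom R A B. \<forall>g \<in> right_hom R A B.
      right_module R A \<and> right_module R B \<and> (\<exists>x \<in> carrier A. f x \<noteq> g x) \<longrightarrow>
      (\<exists>h \<in> right_hom R B C. \<exists>x \<in> carrier A. h (f x) \<noteq> h (g x)))"

text \<open>
  A formula cannot quantify over types, so for a ring with elements of type \<open>'a\<close> the modules are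
  taken on the type \<open>'a set\<close>.  It has room for copies of all right ideals and all cyclic
  modules, and this suffices: the lemmas \<open>right_injective_any_type\<close> and
  \<open>inj_cogenerator_any_type\<close> below carry injectivity, and for an injective regular module
  also the cogenerator property, over to the modules on every other type.
\<close>

definition inj_cogenerator_ring :: "('a, 'x) ring_scheme \<Rightarrow> bool"
  where "inj_cogenerator_ring R \<longleftrightarrow>
    right_injective TYPE('a set) R (rreg R) \<and> right_cogenerator TYPE('a set) R (rreg R)"

definition QF_ring :: "('a, 'x) ring_scheme \<Rightarrow> bool"
  where "QF_ring R \<longleftrightarrow>
    right_noetherian R (rreg R) \<and> right_cogenerator TYPE('a set) R (rreg R)"

subsection \<open>Independence of the type that carries the modules\<close>

text \<open>The copy of \<open>M\<close> along a map that is injective on its carrier.\<close>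

definition rtransport :: "('m \<Rightarrow> 'n) \<Rightarrow> ('a, 'm, 'y) rmodule_scheme \<Rightarrow> ('a, 'n) rmodule"
  where "rtransport j M = (let k = inv_into (carrier M) j in
    \<lparr>carrier = j ` carrier M, mult = undefined, one = undefined,
     zero = j \<zero>\<^bsub>M\<^esub>, add = (\<lambda>x y. j (k x \<oplus>\<^bsub>M\<^esub> k y)),
     rsmult = (\<lambda>x a. j (k x \<cdot>\<^bsub>M\<^esub> a))\<rparr>)"

lemma right_module_rtransport:
  assumes "right_module R M" and inj: "inj_on j (carrier M)"
  shows "right_module R (rtransport j M)"
proof -
  interpret M: right_module R M by fact
  have kj [simp]: "inv_into (carrier M) j (j x) = x" if "x \<in> carrier M" for x
    using inj that by (rule inv_into_f_f)
  show ?thesis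
  proof (intro right_module.intro right_module_axioms.intro abelian_groupI)
    show "ring R" by (rule M.R.ring_axioms)
  next
    fix x assume "x \<in> carrier (rtransport j M)"
    then obtain m where m: "m \<in> carrier M" "x = j m"
      by (auto simp: rtransport_def Let_def)
    then show "\<exists>y\<in>carrier (rtransport j M).
        y \<oplus>\<^bsub>rtransport j M\<^esub> x = \<zero>\<^bsub>rtransport j M\<^esub>"
      by (intro bexI[of _ "j (\<ominus>\<^bsub>M\<^esub> m)"]) (auto simp: rtransport_def Let_def M.M.l_neg)
  qed (auto simp: rtransport_def Let_def M.M.add.m_ac M.rsmult_closed
      M.rsmult_r_distr M.rsmult_l_distr M.rsmult_assoc M.rsmult_one)
qed

lemma right_hom_to_rtransport:
  assumes "right_module R M" "inj_on j (carrier M)"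
  shows "j \<in> right_hom R M (rtransport j M)"
  using assms by (auto simp: right_hom_def rtransport_def Let_def)

lemma right_hom_from_rtransport:
  assumes "right_module R M" "inj_on j (carrier M)"
  shows "inv_into (carrier M) j \<in> right_hom R (rtransport j M) M"
proof -
  interpret M: right_module R M by fact
  show ?thesis
    using assms(2) by (auto simp: right_hom_def rtransport_def Let_def M.rsmult_closed)
qed

lemma right_hom_comp:
  assumes "f \<in> right_hom R L M" "g \<in> right_hom R M N"
  shows "g \<circ> f \<in> right_hom R L N"
  using assms by (auto simp: right_hom_def Pi_iff)

lemma (in right_submodule) right_module_sub:
  assumes "right_module R M"
  shows "right_module R (M\<lparr>carrier := H\<rparr>)"
proof -
  interpret M: right_module R M by fact
  have H: "x \<in> carrier M" if "x \<in> H" for x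
    using that subset by auto
  show ?thesis
  proof (intro right_module.intro right_module_axioms.intro abelian_groupI)
    show "ring R" by (rule M.R.ring_axioms)
  next
    fix x assume "x \<in> carrier (M\<lparr>carrier := H\<rparr>)"
    then have x: "x \<in> H" by simp
    then have "inv\<^bsub>add_monoid M\<^esub> x \<in> H" by (rule m_inv_closed)
    then show "\<exists>y\<in>carrier (M\<lparr>carrier := H\<rparr>).
        y \<oplus>\<^bsub>M\<lparr>carrier := H\<rparr>\<^esub> x = \<zero>\<^bsub>M\<lparr>carrier := H\<rparr>\<^esub>"
      using M.M.l_neg[OF H[OF x]] by (auto simp: a_inv_def)
  next
    fix x y assume "x \<in> carrier (M\<lparr>carrier := H\<rparr>)" "y \<in> carrier (M\<lparr>carrier := H\<rparr>)"
    then show "x \<oplus>\<^bsub>M\<lparr>carrier := H\<rparr>\<^esub> y \<in> carrier (M\<lparr>carrier := H\<rparr>)"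
      using m_closed[of x y] by simp
  next
    show "\<zero>\<^bsub>M\<lparr>carrier := H\<rparr>\<^esub> \<in> carrier (M\<lparr>carrier := H\<rparr>)"
      using one_closed by simp
  qed (simp_all add: H rsmult_closed M.M.add.m_ac
      M.rsmult_r_distr M.rsmult_l_distr M.rsmult_assoc M.rsmult_one)
qed

lemma (in right_module) rsmult_zero_right:
  assumes x: "x \<in> carrier M" shows "x \<cdot>\<^bsub>M\<^esub> \<zero> = \<zero>\<^bsub>M\<^esub>"
proof -
  have c: "x \<cdot>\<^bsub>M\<^esub> \<zero> \<in> carrier M" using x by (simp add: rsmult_closed)
  have "x \<cdot>\<^bsub>M\<^esub> \<zero> \<oplus>\<^bsub>M\<^esub> x \<cdot>\<^bsub>M\<^esub> \<zero> = x \<cdot>\<^bsub>M\<^esub> \<zero>"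
    using rsmult_r_distr[OF x R.zero_closed R.zero_closed] by simp
  then show ?thesis using c by (metis M.add.r_cancel_one')
qed

lemma (in right_module) rsmult_minus:
  assumes x: "x \<in> carrier M" and a: "a \<in> carrier R"
  shows "x \<cdot>\<^bsub>M\<^esub> (\<ominus> a) = \<ominus>\<^bsub>M\<^esub> (x \<cdot>\<^bsub>M\<^esub> a)"
proof -
  have "x \<cdot>\<^bsub>M\<^esub> (\<ominus> a) \<oplus>\<^bsub>M\<^esub> x \<cdot>\<^bsub>M\<^esub> a = \<zero>\<^bsub>M\<^esub>"
    using rsmult_r_distr[OF x, of "\<ominus> a" a] a x by (simp add: R.l_neg rsmult_zero_right)
  then show ?thesis
    using x a by (simp add: M.minus_equality rsmult_closed)
qed

lemma (in right_module) right_submoduleI: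
  assumes "N \<subseteq> carrier M" "\<zero>\<^bsub>M\<^esub> \<in> N"
    and add: "\<And>x y. x \<in> N \<Longrightarrow> y \<in> N \<Longrightarrow> x \<oplus>\<^bsub>M\<^esub> y \<in> N"
    and smult: "\<And>x a. x \<in> N \<Longrightarrow> a \<in> carrier R \<Longrightarrow> x \<cdot>\<^bsub>M\<^esub> a \<in> N"
  shows "right_submodule N R M"
proof (intro right_submodule.intro subgroup.intro right_submodule_axioms.intro)
  fix x assume x: "x \<in> N"
  then have xM: "x \<in> carrier M" using assms(1) by auto
  have "x \<cdot>\<^bsub>M\<^esub> (\<ominus> \<one>) \<in> N" using x by (intro smult) auto
  then show "inv\<^bsub>add_monoid M\<^esub> x \<in> N"
    using rsmult_minus[OF xM R.one_closed] rsmult_one[OF xM] by (simp add: a_inv_def)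
qed (use assms in auto)

lemma right_module_rreg:
  assumes "ring R" shows "right_module R (rreg R)"
proof -
  interpret ring R by fact
  show ?thesis
  proof (intro right_module.intro right_module_axioms.intro abelian_groupI)
    fix x assume "x \<in> carrier (rreg R)"
    then show "\<exists>y\<in>carrier (rreg R). y \<oplus>\<^bsub>rreg R\<^esub> x = \<zero>\<^bsub>rreg R\<^esub>"
      by (intro bexI[of _ "\<ominus>\<^bsub>R\<^esub> x"]) (auto simp: rreg_def l_neg)
  qed (auto simp: rreg_def ring_axioms add.m_ac r_distr l_distr m_assoc)
qed

lemma right_injective_ideals:
  fixes R :: "('a, 'x) ring_scheme" and Q :: "('a, 'q, 'y) rmodule_scheme"
  assumes inj: "right_injective TYPE('a set) R Q"
    and I: "right_submodule I R (rreg R)"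
    and f: "f \<in> right_hom R ((rreg R)\<lparr>carrier := I\<rparr>) Q"
  obtains q where "q \<in> carrier Q" "\<And>r. r \<in> I \<Longrightarrow> f r = q \<cdot>\<^bsub>Q\<^esub> r"
proof -
  interpret Q: right_module R Q using inj by (simp add: right_injective_def)
  let ?I = "(rreg R)\<lparr>carrier := I\<rparr>" and ?j = "\<lambda>r :: 'a. {r}"
  let ?A = "rtransport ?j ?I" and ?B = "rtransport ?j (rreg R)"
  have RR: "right_module R (rreg R)" by (rule right_module_rreg) (rule Q.R.ring_axioms)
  have II: "right_module R ?I" by (rule right_submodule.right_module_sub[OF I RR])
  have IR: "I \<subseteq> carrier R"
    using subgroup.subset[OF right_submodule.axioms(1)[OF I]] by (simp add: rreg_def)
  have j: "inj_on ?j X" for X by (auto simp: inj_on_def)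
  note kA = right_hom_from_rtransport[OF II j]
  have fk: "f \<circ> inv_into (carrier ?I) ?j \<in> right_hom R ?A Q"
    by (rule right_hom_comp[OF kA f])
  have incl: "id \<in> right_hom R ?I (rreg R)"
    using IR by (auto simp: right_hom_def rreg_def)
  let ?i = "?j \<circ> (id \<circ> inv_into (carrier ?I) ?j)"
  have i: "?i \<in> right_hom R ?A ?B"
    by (intro right_hom_comp[OF right_hom_comp[OF kA incl]] right_hom_to_rtransport RR j)
  have kj: "inv_into (carrier ?I) ?j {r} = r" if "r \<in> I" for r
    using inv_into_f_f[OF j, of r "carrier ?I"] that by simp
  have cA: "carrier ?A = ?j ` I" by (simp add: rtransport_def Let_def)
  have "inj_on ?i (carrier ?A)"
    unfolding cA using kj by (auto simp: inj_on_def)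
  then obtain g where g: "g \<in> right_hom R ?B Q"
    and gi: "\<And>x. x \<in> carrier ?A \<Longrightarrow> g (?i x) = (f \<circ> inv_into (carrier ?I) ?j) x"
    using inj i fk right_module_rtransport[OF II j] right_module_rtransport[OF RR j]
    unfolding right_injective_def by meson
  have gj: "g \<circ> ?j \<in> right_hom R (rreg R) Q"
    by (rule right_hom_comp[OF right_hom_to_rtransport[OF RR j] g])
  show thesis
  proof
    show "g {\<one>\<^bsub>R\<^esub>} \<in> carrier Q"
      using gj by (auto simp: right_hom_def rreg_def Pi_iff)
    fix r assume r: "r \<in> I"
    have rR: "r \<in> carrier R" using r IR by auto
    have "\<forall>x\<in>carrier R. \<forall>a\<in>carrier R. g {x \<otimes>\<^bsub>R\<^esub> a} = g {x} \<cdot>\<^bsub>Q\<^esub> a"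
      using gj by (simp add: right_hom_def rreg_def)
    then have "g {\<one>\<^bsub>R\<^esub> \<otimes>\<^bsub>R\<^esub> r} = g {\<one>\<^bsub>R\<^esub>} \<cdot>\<^bsub>Q\<^esub> r"
      using rR Q.R.one_closed by blast
    moreover have "g {r} = f r"
      using gi[of "{r}"] r kj[OF r] by (simp add: cA)
    ultimately show "f r = g {\<one>\<^bsub>R\<^esub>} \<cdot>\<^bsub>Q\<^esub> r"
      using rR by simp
  qed
qed

text \<open>Baer's criterion.\<close>

lemma right_injective_any_type:
  fixes R :: "('a, 'x) ring_scheme" and Q :: "('a, 'q, 'y) rmodule_scheme"
  assumes inj: "right_injective TYPE('a set) R Q"
  shows "right_injective TYPE('m) R Q"
  unfolding right_injective_def
proof (intro conjI allI ballI impI)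
  show RQ: "right_module R Q" using inj by (simp add: right_injective_def)
  fix A B :: "('a, 'm) rmodule" and i f
  assume i: "i \<in> right_hom R A B" and f: "f \<in> right_hom R A Q"
    and AB: "right_module R A \<and> right_module R B \<and> inj_on i (carrier A)"
  interpret Q: right_module R Q by (rule RQ)
  interpret A: right_module R A using AB by simp
  interpret B: right_module R B using AB by simp
  have iinj: "inj_on i (carrier A)" using AB by simp
  have RR: "right_module R (rreg R)" by (rule right_module_rreg) (rule Q.R.ring_axioms)
  interpret RR: right_module R "rreg R" by (rule RR)
  have iD: "i x \<in> carrier B" "i (x \<oplus>\<^bsub>A\<^esub> y) = i x \<oplus>\<^bsub>B\<^esub> i y" "i (x \<cdot>\<^bsub>A\<^esub> a) = i x \<cdot>\<^bsub>B\<^esub> a"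
    if "x \<in> carrier A" "y \<in> carrier A" "a \<in> carrier R" for x y a
    using i that by (auto simp: right_hom_def)
  have fD: "f x \<in> carrier Q" "f (x \<oplus>\<^bsub>A\<^esub> y) = f x \<oplus>\<^bsub>Q\<^esub> f y" "f (x \<cdot>\<^bsub>A\<^esub> a) = f x \<cdot>\<^bsub>Q\<^esub> a"
    if "x \<in> carrier A" "y \<in> carrier A" "a \<in> carrier R" for x y a
    using f that by (auto simp: right_hom_def)
  define G0 where "G0 = (\<lambda>x. (i x, f x)) ` carrier A"
  define P where "P = {G. G0 \<subseteq> G \<and> G \<subseteq> carrier B \<times> carrier Q \<and>
    (\<forall>x p y q. (x, p) \<in> G \<longrightarrow> (y, q) \<in> G \<longrightarrow> (x \<oplus>\<^bsub>B\<^esub> y, p \<oplus>\<^bsub>Q\<^esub> q) \<in> G) \<and>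
    (\<forall>x p. \<forall>a \<in> carrier R. (x, p) \<in> G \<longrightarrow> (x \<cdot>\<^bsub>B\<^esub> a, p \<cdot>\<^bsub>Q\<^esub> a) \<in> G) \<and>
    (\<forall>p. (\<zero>\<^bsub>B\<^esub>, p) \<in> G \<longrightarrow> p = \<zero>\<^bsub>Q\<^esub>)}"
  have i0: "i \<zero>\<^bsub>A\<^esub> = \<zero>\<^bsub>B\<^esub>"
    using iD(3)[OF A.M.zero_closed A.M.zero_closed Q.R.zero_closed] iD(1)[OF A.M.zero_closed A.M.zero_closed Q.R.zero_closed]
    by (simp add: A.rsmult_zero_right B.rsmult_zero_right)
  have f0: "f \<zero>\<^bsub>A\<^esub> = \<zero>\<^bsub>Q\<^esub>"
    using fD(3)[OF A.M.zero_closed A.M.zero_closed Q.R.zero_closed] fD(1)[OF A.M.zero_closed A.M.zero_closed Q.R.zero_closed]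
    by (simp add: A.rsmult_zero_right Q.rsmult_zero_right)
  have G0: "G0 \<in> P"
  proof -
    have "p = \<zero>\<^bsub>Q\<^esub>" if p: "(\<zero>\<^bsub>B\<^esub>, p) \<in> G0" for p
    proof -
      obtain x where x: "x \<in> carrier A" "i x = \<zero>\<^bsub>B\<^esub>" "p = f x"
        using p by (auto simp: G0_def)
      then have "x = \<zero>\<^bsub>A\<^esub>" using i0 iinj by (metis A.M.zero_closed inj_onD)
      then show ?thesis using x f0 by simp
    qed
    moreover have "G0 \<subseteq> carrier B \<times> carrier Q"
      using iD(1)[OF _ A.M.zero_closed Q.R.zero_closed] fD(1)[OF _ A.M.zero_closed Q.R.zero_closed]
      by (auto simp: G0_def)
    moreover have "(x \<oplus>\<^bsub>B\<^esub> y, p \<oplus>\<^bsub>Q\<^esub> q) \<in> G0" if xy: "(x, p) \<in> G0" "(y, q) \<in> G0" for x p y q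
    proof -
      obtain u v where "u \<in> carrier A" "v \<in> carrier A" "x = i u" "p = f u" "y = i v" "q = f v"
        using xy by (auto simp: G0_def)
      then show ?thesis
        using iD(2)[OF _ _ Q.R.zero_closed, of u v] fD(2)[OF _ _ Q.R.zero_closed, of u v]
        unfolding G0_def by (intro image_eqI[of _ _ "u \<oplus>\<^bsub>A\<^esub> v"]) auto
    qed
    moreover have "(x \<cdot>\<^bsub>B\<^esub> a, p \<cdot>\<^bsub>Q\<^esub> a) \<in> G0" if xa: "(x, p) \<in> G0" "a \<in> carrier R" for x p a
    proof -
      obtain u where "u \<in> carrier A" "x = i u" "p = f u"
        using xa by (auto simp: G0_def)
      then show ?thesis
        using iD(3)[of u u a] fD(3)[of u u a] xa(2)
        unfolding G0_def by (intro image_eqI[of _ _ "u \<cdot>\<^bsub>A\<^esub> a"]) (auto simp: A.rsmult_closed)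
    qed
    ultimately show ?thesis unfolding P_def by simp
  qed
  have chains: "\<Union>C \<in> P" if C: "C \<noteq> {}" "subset.chain P C" for C
  proof -
    have CP: "C \<subseteq> P" using C(2) by (simp add: subset.chain_def)
    have tot: "G \<subseteq> H \<or> H \<subseteq> G" if "G \<in> C" "H \<in> C" for G H
      using C(2) that by (auto simp: subset_chain_def)
    have "(x \<oplus>\<^bsub>B\<^esub> y, p \<oplus>\<^bsub>Q\<^esub> q) \<in> \<Union>C" if xy: "(x, p) \<in> \<Union>C" "(y, q) \<in> \<Union>C" for x p y q
    proof -
      obtain G H where GH: "G \<in> C" "(x, p) \<in> G" "H \<in> C" "(y, q) \<in> H" using xy by blast
      then obtain K where "K \<in> C" "(x, p) \<in> K" "(y, q) \<in> K" using tot by blast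
      moreover from this have "K \<in> P" using CP by auto
      ultimately have "(x \<oplus>\<^bsub>B\<^esub> y, p \<oplus>\<^bsub>Q\<^esub> q) \<in> K" unfolding P_def by simp
      then show ?thesis using \<open>K \<in> C\<close> by auto
    qed
    moreover have "(x \<cdot>\<^bsub>B\<^esub> a, p \<cdot>\<^bsub>Q\<^esub> a) \<in> \<Union>C" if xa: "(x, p) \<in> \<Union>C" "a \<in> carrier R" for x p a
    proof -
      obtain K where K: "K \<in> C" "(x, p) \<in> K" using xa by blast
      then have "K \<in> P" using CP by auto
      then have "(x \<cdot>\<^bsub>B\<^esub> a, p \<cdot>\<^bsub>Q\<^esub> a) \<in> K" using K xa unfolding P_def by simp
      then show ?thesis using K by auto
    qed
    moreover have "p = \<zero>\<^bsub>Q\<^esub>" if p: "(\<zero>\<^bsub>B\<^esub>, p) \<in> \<Union>C" for p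
    proof -
      obtain K where K: "K \<in> C" "(\<zero>\<^bsub>B\<^esub>, p) \<in> K" using p by blast
      then have "K \<in> P" using CP by auto
      then show ?thesis using K unfolding P_def by simp
    qed
    moreover have "G0 \<subseteq> \<Union>C" "\<Union>C \<subseteq> carrier B \<times> carrier Q"
    proof -
      obtain K where "K \<in> C" "G0 \<subseteq> K" using C(1) CP unfolding P_def by blast
      then show "G0 \<subseteq> \<Union>C" by blast
      have "\<forall>K\<in>C. K \<subseteq> carrier B \<times> carrier Q" using CP unfolding P_def by auto
      then show "\<Union>C \<subseteq> carrier B \<times> carrier Q" by (simp add: Sup_le_iff)
    qed
    ultimately show ?thesis unfolding P_def by simp
  qed
  obtain M where M: "M \<in> P" and max: "\<And>X. X \<in> P \<Longrightarrow> M \<subseteq> X \<Longrightarrow> X = M"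
    using subset_Zorn_nonempty[OF _ chains] G0 by (metis empty_iff)
  have MBQ: "M \<subseteq> carrier B \<times> carrier Q" and G0M: "G0 \<subseteq> M" using M by (auto simp: P_def)
  have Madd: "(x \<oplus>\<^bsub>B\<^esub> y, p \<oplus>\<^bsub>Q\<^esub> q) \<in> M" if "(x, p) \<in> M" "(y, q) \<in> M" for x p y q
    using M that by (simp add: P_def)
  have Msm: "(x \<cdot>\<^bsub>B\<^esub> a, p \<cdot>\<^bsub>Q\<^esub> a) \<in> M" if "(x, p) \<in> M" "a \<in> carrier R" for x p a
    using M that by (simp add: P_def)
  have M0: "p = \<zero>\<^bsub>Q\<^esub>" if "(\<zero>\<^bsub>B\<^esub>, p) \<in> M" for p
    using M that by (simp add: P_def)
  have M00: "(\<zero>\<^bsub>B\<^esub>, \<zero>\<^bsub>Q\<^esub>) \<in> M"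
  proof -
    have "(i \<zero>\<^bsub>A\<^esub>, f \<zero>\<^bsub>A\<^esub>) \<in> M" using G0M by (auto simp: G0_def)
    then show ?thesis by (simp add: i0 f0)
  qed
  have Mneg: "(\<ominus>\<^bsub>B\<^esub> x, \<ominus>\<^bsub>Q\<^esub> p) \<in> M" if xp: "(x, p) \<in> M" for x p
  proof -
    have c: "x \<in> carrier B" "p \<in> carrier Q" using xp MBQ by auto
    have "(x \<cdot>\<^bsub>B\<^esub> (\<ominus>\<^bsub>R\<^esub> \<one>\<^bsub>R\<^esub>), p \<cdot>\<^bsub>Q\<^esub> (\<ominus>\<^bsub>R\<^esub> \<one>\<^bsub>R\<^esub>)) \<in> M"
      using xp by (intro Msm) auto
    then show ?thesis
      using c by (simp add: B.rsmult_minus Q.rsmult_minus B.rsmult_one Q.rsmult_one)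
  qed
  have Muniq: "p = q" if pq: "(x, p) \<in> M" "(x, q) \<in> M" for x p q
  proof -
    have c: "x \<in> carrier B" "p \<in> carrier Q" "q \<in> carrier Q" using pq MBQ by auto
    have "(x \<oplus>\<^bsub>B\<^esub> \<ominus>\<^bsub>B\<^esub> x, p \<oplus>\<^bsub>Q\<^esub> \<ominus>\<^bsub>Q\<^esub> q) \<in> M" using pq by (intro Madd Mneg)
    then have "p \<oplus>\<^bsub>Q\<^esub> \<ominus>\<^bsub>Q\<^esub> q = \<zero>\<^bsub>Q\<^esub>" using c M0 by (simp add: B.M.r_neg)
    then show ?thesis using c
      by (metis Q.M.minus_equality Q.M.minus_minus Q.M.a_inv_closed)
  qed
  have dom: "\<exists>q. (b, q) \<in> M" if b: "b \<in> carrier B" for b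
  proof -
    define I where "I = {r \<in> carrier R. \<exists>p. (b \<cdot>\<^bsub>B\<^esub> r, p) \<in> M}"
    define \<phi> where "\<phi> r = (THE p. (b \<cdot>\<^bsub>B\<^esub> r, p) \<in> M)" for r
    have phi: "\<phi> r = p" if "(b \<cdot>\<^bsub>B\<^esub> r, p) \<in> M" for r p
      unfolding \<phi>_def using that Muniq by (intro the_equality) auto
    have phiM: "(b \<cdot>\<^bsub>B\<^esub> r, \<phi> r) \<in> M" if "r \<in> I" for r
      using that phi by (auto simp: I_def)
    have IR: "I \<subseteq> carrier R" by (auto simp: I_def)
    have addM: "(b \<cdot>\<^bsub>B\<^esub> (r \<oplus>\<^bsub>R\<^esub> s), \<phi> r \<oplus>\<^bsub>Q\<^esub> \<phi> s) \<in> M" if "r \<in> I" "s \<in> I" for r s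
      using Madd[OF phiM[OF that(1)] phiM[OF that(2)]] that IR b
      by (auto simp: B.rsmult_r_distr subset_iff)
    have smM: "(b \<cdot>\<^bsub>B\<^esub> (r \<otimes>\<^bsub>R\<^esub> s), \<phi> r \<cdot>\<^bsub>Q\<^esub> s) \<in> M" if "r \<in> I" "s \<in> carrier R" for r s
      using Msm[OF phiM[OF that(1)] that(2)] that IR b
      by (auto simp: B.rsmult_assoc subset_iff)
    have I: "right_submodule I R (rreg R)"
    proof (rule RR.right_submoduleI)
      show "I \<subseteq> carrier (rreg R)" using IR by (simp add: rreg_def)
      show "\<zero>\<^bsub>rreg R\<^esub> \<in> I"
        using M00 b by (auto simp: I_def rreg_def B.rsmult_zero_right)
      show "r \<oplus>\<^bsub>rreg R\<^esub> s \<in> I" if "r \<in> I" "s \<in> I" for r s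
        using that addM[OF that] IR by (auto simp: I_def rreg_def)
      show "r \<cdot>\<^bsub>rreg R\<^esub> s \<in> I" if "r \<in> I" "s \<in> carrier R" for r s
        using that smM[OF that] IR by (auto simp: I_def rreg_def)
    qed
    have \<phi>: "\<phi> \<in> right_hom R ((rreg R)\<lparr>carrier := I\<rparr>) Q"
      using phiM MBQ phi[OF addM] phi[OF smM] by (auto simp: right_hom_def rreg_def)
    obtain q where q: "q \<in> carrier Q" "\<And>r. r \<in> I \<Longrightarrow> \<phi> r = q \<cdot>\<^bsub>Q\<^esub> r"
      using right_injective_ideals[OF inj I \<phi>] by blast
    define G where "G = {(x \<oplus>\<^bsub>B\<^esub> b \<cdot>\<^bsub>B\<^esub> r, p \<oplus>\<^bsub>Q\<^esub> q \<cdot>\<^bsub>Q\<^esub> r) | x p r. (x, p) \<in> M \<and> r \<in> carrier R}"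
    have GI: "(x \<oplus>\<^bsub>B\<^esub> b \<cdot>\<^bsub>B\<^esub> r, p \<oplus>\<^bsub>Q\<^esub> q \<cdot>\<^bsub>Q\<^esub> r) \<in> G" if "(x, p) \<in> M" "r \<in> carrier R" for x p r
      using that unfolding G_def by blast
    have GE: "\<exists>y o' r. (y, o') \<in> M \<and> r \<in> carrier R \<and> y \<in> carrier B \<and> o' \<in> carrier Q \<and>
        x = y \<oplus>\<^bsub>B\<^esub> b \<cdot>\<^bsub>B\<^esub> r \<and> p = o' \<oplus>\<^bsub>Q\<^esub> q \<cdot>\<^bsub>Q\<^esub> r" if "(x, p) \<in> G" for x p
      using that MBQ unfolding G_def by blast
    have MG: "M \<subseteq> G"
    proof
      fix z assume z: "z \<in> M"
      then obtain x p where xp: "z = (x, p)" "x \<in> carrier B" "p \<in> carrier Q" using MBQ by auto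
      then show "z \<in> G"
        using GI[of x p "\<zero>\<^bsub>R\<^esub>"] z b q by (simp add: B.rsmult_zero_right Q.rsmult_zero_right)
    qed
    have "G \<in> P"
    proof -
      have "G \<subseteq> carrier B \<times> carrier Q"
        using MBQ b q by (auto simp: G_def B.rsmult_closed Q.rsmult_closed)
      moreover have "(x \<oplus>\<^bsub>B\<^esub> y, p \<oplus>\<^bsub>Q\<^esub> s) \<in> G" if xy: "(x, p) \<in> G" "(y, s) \<in> G" for x p y s
      proof -
        obtain x' p' r where 1: "(x', p') \<in> M" "r \<in> carrier R" "x' \<in> carrier B" "p' \<in> carrier Q"
          "x = x' \<oplus>\<^bsub>B\<^esub> b \<cdot>\<^bsub>B\<^esub> r" "p = p' \<oplus>\<^bsub>Q\<^esub> q \<cdot>\<^bsub>Q\<^esub> r" using GE[OF xy(1)] by blast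
        obtain y' s' t where 2: "(y', s') \<in> M" "t \<in> carrier R" "y' \<in> carrier B" "s' \<in> carrier Q"
          "y = y' \<oplus>\<^bsub>B\<^esub> b \<cdot>\<^bsub>B\<^esub> t" "s = s' \<oplus>\<^bsub>Q\<^esub> q \<cdot>\<^bsub>Q\<^esub> t" using GE[OF xy(2)] by blast
        have "((x' \<oplus>\<^bsub>B\<^esub> y') \<oplus>\<^bsub>B\<^esub> b \<cdot>\<^bsub>B\<^esub> (r \<oplus>\<^bsub>R\<^esub> t), (p' \<oplus>\<^bsub>Q\<^esub> s') \<oplus>\<^bsub>Q\<^esub> q \<cdot>\<^bsub>Q\<^esub> (r \<oplus>\<^bsub>R\<^esub> t)) \<in> G"
          using 1 2 by (intro GI Madd) auto
        moreover have "(x' \<oplus>\<^bsub>B\<^esub> y') \<oplus>\<^bsub>B\<^esub> b \<cdot>\<^bsub>B\<^esub> (r \<oplus>\<^bsub>R\<^esub> t) = x \<oplus>\<^bsub>B\<^esub> y"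
          using 1 2 b by (simp add: B.rsmult_r_distr B.rsmult_closed B.M.add.m_ac)
        moreover have "(p' \<oplus>\<^bsub>Q\<^esub> s') \<oplus>\<^bsub>Q\<^esub> q \<cdot>\<^bsub>Q\<^esub> (r \<oplus>\<^bsub>R\<^esub> t) = p \<oplus>\<^bsub>Q\<^esub> s"
          using 1 2 q by (simp add: Q.rsmult_r_distr Q.rsmult_closed Q.M.add.m_ac)
        ultimately show ?thesis by simp
      qed
      moreover have "(x \<cdot>\<^bsub>B\<^esub> a, p \<cdot>\<^bsub>Q\<^esub> a) \<in> G" if xa: "(x, p) \<in> G" "a \<in> carrier R" for x p a
      proof -
        obtain x' p' r where 1: "(x', p') \<in> M" "r \<in> carrier R" "x' \<in> carrier B" "p' \<in> carrier Q"
          "x = x' \<oplus>\<^bsub>B\<^esub> b \<cdot>\<^bsub>B\<^esub> r" "p = p' \<oplus>\<^bsub>Q\<^esub> q \<cdot>\<^bsub>Q\<^esub> r" using GE[OF xa(1)] by blast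
        have "(x' \<cdot>\<^bsub>B\<^esub> a \<oplus>\<^bsub>B\<^esub> b \<cdot>\<^bsub>B\<^esub> (r \<otimes>\<^bsub>R\<^esub> a), p' \<cdot>\<^bsub>Q\<^esub> a \<oplus>\<^bsub>Q\<^esub> q \<cdot>\<^bsub>Q\<^esub> (r \<otimes>\<^bsub>R\<^esub> a)) \<in> G"
          using 1 xa by (intro GI Msm) auto
        then show ?thesis
          using 1 xa b q by (simp add: B.rsmult_l_distr Q.rsmult_l_distr B.rsmult_closed
              Q.rsmult_closed B.rsmult_assoc Q.rsmult_assoc)
      qed
      moreover have "p = \<zero>\<^bsub>Q\<^esub>" if p: "(\<zero>\<^bsub>B\<^esub>, p) \<in> G" for p
      proof -
        obtain x' p' r where 1: "(x', p') \<in> M" "r \<in> carrier R" "x' \<in> carrier B" "p' \<in> carrier Q"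
          "\<zero>\<^bsub>B\<^esub> = x' \<oplus>\<^bsub>B\<^esub> b \<cdot>\<^bsub>B\<^esub> r" "p = p' \<oplus>\<^bsub>Q\<^esub> q \<cdot>\<^bsub>Q\<^esub> r" using GE[OF p] by blast
        have br: "b \<cdot>\<^bsub>B\<^esub> r = \<ominus>\<^bsub>B\<^esub> x'"
          using 1 b by (metis B.M.a_comm B.M.minus_equality B.rsmult_closed)
        then have "(b \<cdot>\<^bsub>B\<^esub> r, \<ominus>\<^bsub>Q\<^esub> p') \<in> M" using Mneg[OF 1(1)] by simp
        then have "r \<in> I" "\<phi> r = \<ominus>\<^bsub>Q\<^esub> p'" using phi 1(2) by (auto simp: I_def)
        then have "q \<cdot>\<^bsub>Q\<^esub> r = \<ominus>\<^bsub>Q\<^esub> p'" using q(2) by simp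
        then show ?thesis using 1 by (simp add: Q.M.r_neg)
      qed
      ultimately show ?thesis using G0M MG unfolding P_def by auto
    qed
    then have "G = M" using MG by (rule max)
    moreover have "(b, q) \<in> G"
      using GI[OF M00 Q.R.one_closed] b q by (simp add: B.rsmult_one Q.rsmult_one)
    ultimately show ?thesis by auto
  qed
  define g where "g b = (THE q. (b, q) \<in> M)" for b
  have gE: "g b = q" if "(b, q) \<in> M" for b q
    unfolding g_def using that Muniq by (intro the_equality) auto
  have gM: "(b, g b) \<in> M" if "b \<in> carrier B" for b
    using dom[OF that] gE by auto
  show "\<exists>g\<in>right_hom R B Q. \<forall>x\<in>carrier A. g (i x) = f x"
  proof (intro bexI ballI)
    show "g (i x) = f x" if "x \<in> carrier A" for x
      using that G0M by (intro gE) (auto simp: G0_def)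
    show "g \<in> right_hom R B Q"
      using gM MBQ gE[OF Madd[OF gM gM]] gE[OF Msm[OF gM]] by (auto simp: right_hom_def)
  qed
qed

lemma inj_cogenerator_any_type:
  fixes R :: "('a, 'x) ring_scheme"
  assumes "inj_cogenerator_ring R"
  shows "right_injective TYPE('m) R (rreg R)" "right_cogenerator TYPE('m) R (rreg R)"
proof -
  have inj: "right_injective TYPE('a set) R (rreg R)" and cog: "right_cogenerator TYPE('a set) R (rreg R)"
    using assms by (auto simp: inj_cogenerator_ring_def)
  show injm: "right_injective TYPE('m) R (rreg R)"
    using inj by (rule right_injective_any_type)
  have RR: "right_module R (rreg R)" using inj by (simp add: right_injective_def)
  interpret RR: right_module R "rreg R" by (rule RR)
  have sep: "\<exists>h \<in> right_hom R M (rreg R). h x \<noteq> \<zero>\<^bsub>R\<^esub>"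
    if M: "right_module R M" and x: "x \<in> carrier M" "x \<noteq> \<zero>\<^bsub>M\<^esub>" for M :: "('a, 'm) rmodule" and x
  proof -
    interpret M: right_module R M by (rule M)
    define N where "N = (\<lambda>r. x \<cdot>\<^bsub>M\<^esub> r) ` carrier R"
    have N: "right_submodule N R M"
    proof (rule M.right_submoduleI)
      show "N \<subseteq> carrier M" using x by (auto simp: N_def M.rsmult_closed)
      show "\<zero>\<^bsub>M\<^esub> \<in> N" unfolding N_def
        using x by (intro image_eqI[of _ _ "\<zero>\<^bsub>R\<^esub>"]) (auto simp: M.rsmult_zero_right)
      show "y \<oplus>\<^bsub>M\<^esub> z \<in> N" if "y \<in> N" "z \<in> N" for y z
        using that x unfolding N_def by (auto simp: M.rsmult_r_distr[symmetric])
      show "y \<cdot>\<^bsub>M\<^esub> a \<in> N" if "y \<in> N" "a \<in> carrier R" for y a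
        using that x unfolding N_def by (auto simp: M.rsmult_assoc[symmetric])
    qed
    let ?N = "M\<lparr>carrier := N\<rparr>"
    have NM: "N \<subseteq> carrier M" using x by (auto simp: N_def M.rsmult_closed)
    have NN: "right_module R ?N" by (rule right_submodule.right_module_sub[OF N M])
    interpret NN: right_module R ?N by (rule NN)
    define j where "j y = {r \<in> carrier R. x \<cdot>\<^bsub>M\<^esub> r = y}" for y
    have j: "inj_on j (carrier ?N)"
    proof (rule inj_onI)
      fix y z assume yz: "y \<in> carrier ?N" "z \<in> carrier ?N" "j y = j z"
      then obtain r where "r \<in> carrier R" "y = x \<cdot>\<^bsub>M\<^esub> r" by (auto simp: N_def)
      then have "r \<in> j z" using yz(3) by (auto simp: j_def)
      then show "y = z" using \<open>y = x \<cdot>\<^bsub>M\<^esub> r\<close> by (simp add: j_def)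
    qed
    let ?A = "rtransport j ?N"
    have A: "right_module R ?A" by (rule right_module_rtransport[OF NN j])
    interpret A: right_module R ?A by (rule A)
    have idA: "id \<in> right_hom R ?A ?A" by (auto simp: right_hom_def)
    have zA: "(\<lambda>_. \<zero>\<^bsub>?A\<^esub>) \<in> right_hom R ?A ?A"
    proof -
      have "\<zero>\<^bsub>?A\<^esub> \<cdot>\<^bsub>?A\<^esub> a = \<zero>\<^bsub>?A\<^esub>" if a: "a \<in> carrier R" for a
      proof -
        have "\<zero>\<^bsub>?A\<^esub> \<cdot>\<^bsub>?A\<^esub> a \<oplus>\<^bsub>?A\<^esub> \<zero>\<^bsub>?A\<^esub> \<cdot>\<^bsub>?A\<^esub> a = \<zero>\<^bsub>?A\<^esub> \<cdot>\<^bsub>?A\<^esub> a"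
          using A.rsmult_l_distr[OF A.M.zero_closed A.M.zero_closed a] by simp
        then show ?thesis
          using A.rsmult_closed[OF A.M.zero_closed a] by (metis A.M.add.r_cancel_one')
      qed
      then show ?thesis by (auto simp: right_hom_def)
    qed
    have xN: "x \<in> N" unfolding N_def
      using x by (intro image_eqI[of _ _ "\<one>\<^bsub>R\<^esub>"]) (auto simp: M.rsmult_one)
    have jx: "j x \<in> carrier ?A" using xN by (simp add: rtransport_def Let_def)
    have zj: "\<zero>\<^bsub>?A\<^esub> = j \<zero>\<^bsub>M\<^esub>" by (simp add: rtransport_def Let_def)
    have "j x \<noteq> j \<zero>\<^bsub>M\<^esub>"
      using j xN x(2) NN.M.zero_closed by (auto simp: inj_on_def)
    then have ex: "\<exists>y\<in>carrier ?A. id y \<noteq> \<zero>\<^bsub>?A\<^esub>"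
      using jx zj by (intro bexI[of _ "j x"]) simp_all
    have "\<exists>h\<in>right_hom R ?A (rreg R). \<exists>y\<in>carrier ?A. h (id y) \<noteq> h \<zero>\<^bsub>?A\<^esub>"
      by (rule cog[unfolded right_cogenerator_def, THEN conjunct2, rule_format, OF idA zA])
        (intro conjI A ex)
    then obtain h y where h: "h \<in> right_hom R ?A (rreg R)" and y: "y \<in> carrier ?A" "h y \<noteq> h \<zero>\<^bsub>?A\<^esub>"
      by auto
    have hj: "h \<circ> j \<in> right_hom R ?N (rreg R)"
      by (rule right_hom_comp[OF right_hom_to_rtransport[OF NN j] h])
    have incl: "id \<in> right_hom R ?N M" using NM by (auto simp: right_hom_def)
    have "\<exists>g\<in>right_hom R M (rreg R). \<forall>z\<in>carrier ?N. g (id z) = (h \<circ> j) z"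
      by (rule injm[unfolded right_injective_def, THEN conjunct2, rule_format, OF incl hj])
        (intro conjI NN M inj_on_id)
    then obtain g where g: "g \<in> right_hom R M (rreg R)" "\<And>z. z \<in> N \<Longrightarrow> g z = h (j z)"
      by auto
    have gD: "g (x \<cdot>\<^bsub>M\<^esub> a) = g x \<otimes>\<^bsub>R\<^esub> a" if "a \<in> carrier R" for a
      using g(1) that x by (auto simp: right_hom_def rreg_def)
    obtain r where r: "r \<in> carrier R" "y = j (x \<cdot>\<^bsub>M\<^esub> r)"
      using y(1) by (auto simp: rtransport_def Let_def N_def)
    have "g (x \<cdot>\<^bsub>M\<^esub> r) \<noteq> g (x \<cdot>\<^bsub>M\<^esub> \<zero>\<^bsub>R\<^esub>)"
      using y(2) r g(2) x zj by (auto simp: N_def M.rsmult_zero_right[symmetric])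
    then have "g x \<noteq> \<zero>\<^bsub>R\<^esub>" using r gD by auto
    then show ?thesis using g(1) by blast
  qed
  show "right_cogenerator TYPE('m) R (rreg R)"
    unfolding right_cogenerator_def
  proof (intro conjI allI ballI impI)
    show "right_module R (rreg R)" by (rule RR)
    fix A B :: "('a, 'm) rmodule" and f g
    assume f: "f \<in> right_hom R A B" and g: "g \<in> right_hom R A B"
      and AB: "right_module R A \<and> right_module R B \<and> (\<exists>x\<in>carrier A. f x \<noteq> g x)"
    interpret B: right_module R B using AB by simp
    obtain x where x: "x \<in> carrier A" "f x \<noteq> g x" using AB by auto
    have c: "f x \<in> carrier B" "g x \<in> carrier B" using f g x by (auto simp: right_hom_def)
    have d: "(f x \<ominus>\<^bsub>B\<^esub> g x) \<oplus>\<^bsub>B\<^esub> g x = f x"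
      using c by (simp add: B.M.minus_eq B.M.a_assoc B.M.l_neg)
    have "f x \<ominus>\<^bsub>B\<^esub> g x \<noteq> \<zero>\<^bsub>B\<^esub>"
      using d c x(2) by auto
    then obtain h where h: "h \<in> right_hom R B (rreg R)" "h (f x \<ominus>\<^bsub>B\<^esub> g x) \<noteq> \<zero>\<^bsub>R\<^esub>"
      using sep[of B "f x \<ominus>\<^bsub>B\<^esub> g x"] AB c by auto
    have "h (f x) \<noteq> h (g x)"
    proof
      assume eq: "h (f x) = h (g x)"
      have hc: "h (f x \<ominus>\<^bsub>B\<^esub> g x) \<in> carrier R" "h (g x) \<in> carrier R"
        using h(1) c by (auto simp: right_hom_def rreg_def Pi_iff)
      have "h ((f x \<ominus>\<^bsub>B\<^esub> g x) \<oplus>\<^bsub>B\<^esub> g x) = h (f x \<ominus>\<^bsub>B\<^esub> g x) \<oplus>\<^bsub>R\<^esub> h (g x)"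
        using h(1) c by (auto simp: right_hom_def rreg_def)
      then have "h (f x \<ominus>\<^bsub>B\<^esub> g x) \<oplus>\<^bsub>R\<^esub> h (g x) = h (g x)" using eq d by simp
      then have "h (f x \<ominus>\<^bsub>B\<^esub> g x) = \<zero>\<^bsub>R\<^esub>"
        using hc by (metis RR.R.add.r_cancel_one')
      then show False using h(2) by simp
    qed
    then show "\<exists>h\<in>right_hom R B (rreg R). \<exists>x\<in>carrier A. h (f x) \<noteq> h (g x)"
      using h(1) x(1) by blast
  qed
qed

section \<open>Pairings\<close>

text \<open>The value \<open>\<langle>v, w\<rangle>\<close> of the pairing is \<open>\<kappa> v w\<close>.\<close>

locale left_pairing = V?: right_module R V + W?: left_module R W
  for R :: "('a, 'x) ring_scheme" (structure)
    and V :: "('a, 'v, 'y) rmodule_scheme" (structure)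
    and W :: "('a, 'w, 'z) module_scheme" (structure) +
  fixes \<kappa> :: "'v \<Rightarrow> 'w \<Rightarrow> 'a"
  assumes kappa_hom: "\<kappa> \<in> right_hom R V (ldual R W)"

definition chi :: "('a, 'v, 'y) rmodule_scheme \<Rightarrow> ('v \<Rightarrow> 'w \<Rightarrow> 'a) \<Rightarrow> 'w \<Rightarrow> ('v \<Rightarrow> 'a)"
  where "chi V \<kappa> w = (\<lambda>v\<in>carrier V. \<kappa> v w)"

text \<open>\<open>perp_right X\<close> is \<open>X\<^sup>\<bottom> \<subseteq> W\<close> for \<open>X \<subseteq> V\<close>, and \<open>perp_left K\<close> is \<open>K\<^sup>\<bottom> \<subseteq> V\<close> for \<open>K \<subseteq> W\<close>.\<close>

definition perp_right ::
    "('a, 'x) ring_scheme \<Rightarrow> ('a, 'w, 'z) module_scheme \<Rightarrow> ('v \<Rightarrow> 'w \<Rightarrow> 'a) \<Rightarrow> 'v set \<Rightarrow> 'w set"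
  where "perp_right R W \<kappa> X = {w \<in> carrier W. \<forall>x\<in>X. \<kappa> x w = \<zero>\<^bsub>R\<^esub>}"

definition perp_left ::
    "('a, 'x) ring_scheme \<Rightarrow> ('a, 'v, 'y) rmodule_scheme \<Rightarrow> ('v \<Rightarrow> 'w \<Rightarrow> 'a) \<Rightarrow> 'w set \<Rightarrow> 'v set"
  where "perp_left R V \<kappa> K = {v \<in> carrier V. \<forall>k\<in>K. \<kappa> v k = \<zero>\<^bsub>R\<^esub>}"

definition An :: "('a, 'x) ring_scheme \<Rightarrow> ('a, 'v, 'y) rmodule_scheme \<Rightarrow> 'v set \<Rightarrow> ('v \<Rightarrow> 'a) set"
  where "An R V X = {g \<in> carrier (rdual R V). \<forall>x\<in>X. g x = \<zero>\<^bsub>R\<^esub>}"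

definition weak_topology ::
    "('a, 'x) ring_scheme \<Rightarrow> ('a, 'v, 'y) rmodule_scheme \<Rightarrow> ('a, 'w, 'z) module_scheme \<Rightarrow>
     ('v \<Rightarrow> 'w \<Rightarrow> 'a) \<Rightarrow> 'v topology"
  where "weak_topology R V W \<kappa> = topology (\<lambda>U. U \<subseteq> carrier V \<and>
    (\<forall>x\<in>U. \<exists>F. finite F \<and> F \<subseteq> carrier W \<and> (\<forall>y \<in> perp_left R V \<kappa> F. x \<oplus>\<^bsub>V\<^esub> y \<in> U)))"

lemma openin_weak_topology:
  "openin (weak_topology R V W \<kappa>) U \<longleftrightarrow> U \<subseteq> carrier V \<and>
    (\<forall>x\<in>U. \<exists>F. finite F \<and> F \<subseteq> carrier W \<and> (\<forall>y \<in> perp_left R V \<kappa> F. x \<oplus>\<^bsub>V\<^esub> y \<in> U))"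
proof -
  let ?L = "\<lambda>U. U \<subseteq> carrier V \<and>
    (\<forall>x\<in>U. \<exists>F. finite F \<and> F \<subseteq> carrier W \<and> (\<forall>y \<in> perp_left R V \<kappa> F. x \<oplus>\<^bsub>V\<^esub> y \<in> U))"
  have inter: "?L (S \<inter> T)" if S: "?L S" and T: "?L T" for S T
  proof (intro conjI ballI)
    show "S \<inter> T \<subseteq> carrier V" using S by blast
    fix x assume x: "x \<in> S \<inter> T"
    obtain F where F: "finite F" "F \<subseteq> carrier W" "\<forall>y \<in> perp_left R V \<kappa> F. x \<oplus>\<^bsub>V\<^esub> y \<in> S"
      using S x by blast
    obtain G where G: "finite G" "G \<subseteq> carrier W" "\<forall>y \<in> perp_left R V \<kappa> G. x \<oplus>\<^bsub>V\<^esub> y \<in> T"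
      using T x by blast
    have "perp_left R V \<kappa> (F \<union> G) = perp_left R V \<kappa> F \<inter> perp_left R V \<kappa> G"
      by (auto simp: perp_left_def)
    then show "\<exists>F. finite F \<and> F \<subseteq> carrier W \<and> (\<forall>y \<in> perp_left R V \<kappa> F. x \<oplus>\<^bsub>V\<^esub> y \<in> S \<inter> T)"
      using F G by (intro exI[of _ "F \<union> G"]) auto
  qed
  have union: "?L (\<Union>\<K>)" if K: "\<forall>K\<in>\<K>. ?L K" for \<K>
  proof (intro conjI ballI)
    show "\<Union>\<K> \<subseteq> carrier V" using K by blast
    fix x assume "x \<in> \<Union>\<K>"
    then obtain K' where K': "K' \<in> \<K>" "x \<in> K'" by blast
    have "?L K'" using K K'(1) by (rule bspec)
    then obtain F where "finite F" "F \<subseteq> carrier W" "\<forall>y \<in> perp_left R V \<kappa> F. x \<oplus>\<^bsub>V\<^esub> y \<in> K'"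
      using K'(2) by meson
    then show "\<exists>F. finite F \<and> F \<subseteq> carrier W \<and> (\<forall>y \<in> perp_left R V \<kappa> F. x \<oplus>\<^bsub>V\<^esub> y \<in> \<Union>\<K>)"
      using K' by blast
  qed
  have L_Int: "\<forall>S T. ?L S \<longrightarrow> ?L T \<longrightarrow> ?L (S \<inter> T)"
    by (intro allI) (rule impI, rule impI, rule inter)
  have L_Un: "\<forall>\<K>. (\<forall>K\<in>\<K>. ?L K) \<longrightarrow> ?L (\<Union>\<K>)"
    by (intro allI) (rule impI, rule union)
  have "istopology ?L"
    unfolding istopology_def by (rule conjI[OF L_Int L_Un])
  then show ?thesis
    unfolding weak_topology_def by (simp only: topology_inverse')
qed

lemma topspace_weak_topology:
  assumes "abelian_group V"
  shows "topspace (weak_topology R V W \<kappa>) = carrier V"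
proof -
  interpret V: abelian_group V by fact
  have "openin (weak_topology R V W \<kappa>) (carrier V)"
    unfolding openin_weak_topology perp_left_def by auto
  then show ?thesis
    using openin_topspace[of "weak_topology R V W \<kappa>"] openin_subset
    unfolding openin_weak_topology[of R V W \<kappa> "topspace (weak_topology R V W \<kappa>)"]
    by (intro subset_antisym) auto
qed

definition dense_in :: "'v topology \<Rightarrow> 'v set \<Rightarrow> 'v set \<Rightarrow> bool"
  where "dense_in T X Y \<longleftrightarrow> X \<subseteq> Y \<and> subtopology T Y closure_of X = Y"

end

theory Submission
  imports Defs
begin

text \<open>
  Injectivity of \<open>R\<close> shows, by induction on \<open>F\<close>, that a functional on \<open>V\<close> vanishing on
  \<open>F\<^sup>\<bottom>\<close> for a finite \<open>F \<subseteq> W\<close> is of the form \<open>\<langle>-, w\<rangle>\<close> with \<open>w\<close> in the span of \<open>F\<close>.  If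
  \<open>v \<notin> X + F\<^sup>\<bottom>\<close>, then the cogenerator property provides a functional that separates \<open>v\<close> from
  \<open>X + F\<^sup>\<bottom>\<close>; it is represented by some \<open>w \<in> X\<^sup>\<bottom>\<close>, hence \<open>v \<notin> X\<^sup>\<bottom>\<^sup>\<bottom>\<close>.  This gives (1), and
  (2) and (4) follow formally.

  For (3) and (5) the point is that if \<open>V / K\<^sup>\<bottom>\<close> is finitely generated, then \<open>K\<^sup>\<bottom> = F\<^sup>\<bottom>\<close> for
  a finite \<open>F \<subseteq> K\<close>.  Instead of proving that a QF ring is Artinian, one uses that over a
  right Noetherian right self-injective ring every nonzero right module has a simple
  submodule: a submodule \<open>N \<supseteq> K\<^sup>\<bottom>\<close> with \<open>F\<^sup>\<bottom> \<inter> N = K\<^sup>\<bottom>\<close> for some finite \<open>F \<subseteq> K\<close> can be enlarged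
  by a simple extension at the cost of one more element of \<open>K\<close>, so a maximal such \<open>N\<close> is \<open>V\<close>.
  To find a simple submodule, let \<open>Z\<close> be the set of elements with essential right
  annihilator.  It is nilpotent, so some \<open>m \<noteq> 0\<close> has \<open>m Z = 0\<close>.  Among the \<open>t\<close> with \<open>m t \<noteq> 0\<close>
  choose one with maximal right annihilator.  If \<open>m t a \<noteq> 0\<close>, then \<open>t a \<notin> Z\<close>, so injectivity
  gives \<open>c\<close> and \<open>b \<noteq> 0\<close> with \<open>c t a b = b\<close>; now \<open>t - t a c t\<close> annihilates more than \<open>t\<close> does, so
  \<open>m t = m t a c t\<close>, and \<open>m t R\<close> is simple.
\<close>

section \<open>Submodules, homomorphisms and quotients\<close>

context right_module
begin

lemma zero_rsmult:
  assumes "a \<in> carrier R" shows "\<zero>\<^bsub>M\<^esub> \<cdot>\<^bsub>M\<^esub> a = \<zero>\<^bsub>M\<^esub>"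
proof -
  have "\<zero>\<^bsub>M\<^esub> \<cdot>\<^bsub>M\<^esub> a \<oplus>\<^bsub>M\<^esub> \<zero>\<^bsub>M\<^esub> \<cdot>\<^bsub>M\<^esub> a = \<zero>\<^bsub>M\<^esub> \<cdot>\<^bsub>M\<^esub> a"
    using rsmult_l_distr[OF M.zero_closed M.zero_closed assms] by simp
  then show ?thesis
    using rsmult_closed[OF M.zero_closed assms] by (metis M.add.r_cancel_one')
qed

lemma minus_rsmult:
  assumes x: "x \<in> carrier M" and a: "a \<in> carrier R"
  shows "(\<ominus>\<^bsub>M\<^esub> x) \<cdot>\<^bsub>M\<^esub> a = \<ominus>\<^bsub>M\<^esub> (x \<cdot>\<^bsub>M\<^esub> a)"
proof -
  have "(\<ominus>\<^bsub>M\<^esub> x) \<cdot>\<^bsub>M\<^esub> a \<oplus>\<^bsub>M\<^esub> x \<cdot>\<^bsub>M\<^esub> a = \<zero>\<^bsub>M\<^esub>"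
    using rsmult_l_distr[of "\<ominus>\<^bsub>M\<^esub> x" x a] a x by (simp add: M.l_neg zero_rsmult)
  then show ?thesis
    using x a by (simp add: M.minus_equality rsmult_closed)
qed

lemma rsmult_minus_distr:
  assumes "x \<in> carrier M" "a \<in> carrier R" "b \<in> carrier R"
  shows "x \<cdot>\<^bsub>M\<^esub> (a \<ominus> b) = x \<cdot>\<^bsub>M\<^esub> a \<ominus>\<^bsub>M\<^esub> x \<cdot>\<^bsub>M\<^esub> b"
  using assms by (simp add: R.minus_eq M.minus_eq rsmult_r_distr rsmult_minus)

lemma right_submoduleD:
  assumes N: "right_submodule N R M"
  shows "N \<subseteq> carrier M" "\<And>x. x \<in> N \<Longrightarrow> x \<in> carrier M" "\<zero>\<^bsub>M\<^esub> \<in> N"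
    and "\<And>x y. x \<in> N \<Longrightarrow> y \<in> N \<Longrightarrow> x \<oplus>\<^bsub>M\<^esub> y \<in> N"
    and "\<And>x. x \<in> N \<Longrightarrow> \<ominus>\<^bsub>M\<^esub> x \<in> N"
    and "\<And>x y. x \<in> N \<Longrightarrow> y \<in> N \<Longrightarrow> x \<ominus>\<^bsub>M\<^esub> y \<in> N"
    and "\<And>x a. x \<in> N \<Longrightarrow> a \<in> carrier R \<Longrightarrow> x \<cdot>\<^bsub>M\<^esub> a \<in> N"
proof -
  interpret N: right_submodule N R M by (rule N)
  show "N \<subseteq> carrier M" and [simp]: "x \<in> N \<Longrightarrow> x \<in> carrier M" for x
    using N.subset by auto
  show "\<zero>\<^bsub>M\<^esub> \<in> N" using N.one_closed by simp
  show add: "x \<in> N \<Longrightarrow> y \<in> N \<Longrightarrow> x \<oplus>\<^bsub>M\<^esub> y \<in> N" for x y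
    using N.m_closed by simp
  show neg: "x \<in> N \<Longrightarrow> \<ominus>\<^bsub>M\<^esub> x \<in> N" for x
    using N.m_inv_closed by (simp add: a_inv_def)
  show "x \<in> N \<Longrightarrow> y \<in> N \<Longrightarrow> x \<ominus>\<^bsub>M\<^esub> y \<in> N" for x y
    by (simp add: M.minus_eq add neg)
  show "x \<in> N \<Longrightarrow> a \<in> carrier R \<Longrightarrow> x \<cdot>\<^bsub>M\<^esub> a \<in> N" for x a
    by (rule N.rsmult_closed)
qed

lemma right_submodule_carrier: "right_submodule (carrier M) R M"
  by (rule right_submoduleI) (auto simp: rsmult_closed)

lemma right_submodule_Int:
  assumes "right_submodule N R M" "right_submodule L R M"
  shows "right_submodule (N \<inter> L) R M"
  using right_submoduleD[OF assms(1)] right_submoduleD[OF assms(2)]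
  by (intro right_submoduleI) auto

text \<open>This is the submodule N + vR. The explicit coefficient \<open>r\<close> lets
  \<open>simple_extension_finite_perp\<close> compare elements through their coefficients at
  \<open>v\<close>.\<close>

definition adjoin :: "'m set \<Rightarrow> 'm \<Rightarrow> 'm set"
  where "adjoin N v = {x \<oplus>\<^bsub>M\<^esub> v \<cdot>\<^bsub>M\<^esub> r | x r. x \<in> N \<and> r \<in> carrier R}"

lemma adjoinI: "x \<in> N \<Longrightarrow> r \<in> carrier R \<Longrightarrow> x \<oplus>\<^bsub>M\<^esub> v \<cdot>\<^bsub>M\<^esub> r \<in> adjoin N v"
  unfolding adjoin_def by blast

lemma adjoinE:
  assumes "u \<in> adjoin N v"
  obtains x r where "x \<in> N" "r \<in> carrier R" "u = x \<oplus>\<^bsub>M\<^esub> v \<cdot>\<^bsub>M\<^esub> r"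
  using assms by (auto simp: adjoin_def)

lemma
  assumes N: "right_submodule N R M" and v: "v \<in> carrier M"
  shows right_submodule_adjoin: "right_submodule (adjoin N v) R M"
    and subset_adjoin: "N \<subseteq> adjoin N v"
    and mem_adjoin: "v \<in> adjoin N v"
proof -
  note D [simp] = right_submoduleD[OF N]
  show "N \<subseteq> adjoin N v"
  proof
    fix x assume "x \<in> N"
    then show "x \<in> adjoin N v"
      using v unfolding adjoin_def
      by (intro CollectI exI[of _ x] exI[of _ "\<zero>"]) (auto simp: rsmult_zero_right)
  qed
  then have z: "\<zero>\<^bsub>M\<^esub> \<in> adjoin N v" using D(3) by blast
  show "v \<in> adjoin N v"
    using v unfolding adjoin_def
    by (intro CollectI exI[of _ "\<zero>\<^bsub>M\<^esub>"] exI[of _ "\<one>"]) (auto simp: rsmult_one)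
  show "right_submodule (adjoin N v) R M"
  proof (rule right_submoduleI)
    show "adjoin N v \<subseteq> carrier M" using v by (auto simp: adjoin_def rsmult_closed)
    show "\<zero>\<^bsub>M\<^esub> \<in> adjoin N v" by (rule z)
  next
    fix x y assume "x \<in> adjoin N v" "y \<in> adjoin N v"
    then obtain p q r s where *: "p \<in> N" "q \<in> N" "r \<in> carrier R" "s \<in> carrier R"
      "x = p \<oplus>\<^bsub>M\<^esub> v \<cdot>\<^bsub>M\<^esub> r" "y = q \<oplus>\<^bsub>M\<^esub> v \<cdot>\<^bsub>M\<^esub> s"
      by (metis adjoinE)
    then have "x \<oplus>\<^bsub>M\<^esub> y = (p \<oplus>\<^bsub>M\<^esub> q) \<oplus>\<^bsub>M\<^esub> v \<cdot>\<^bsub>M\<^esub> (r \<oplus> s)"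
      using v by (simp add: rsmult_r_distr rsmult_closed M.add.m_ac)
    moreover have "(p \<oplus>\<^bsub>M\<^esub> q) \<oplus>\<^bsub>M\<^esub> v \<cdot>\<^bsub>M\<^esub> (r \<oplus> s) \<in> adjoin N v"
      using * by (intro adjoinI) auto
    ultimately show "x \<oplus>\<^bsub>M\<^esub> y \<in> adjoin N v" by simp
  next
    fix x a assume "x \<in> adjoin N v" and a: "a \<in> carrier R"
    then obtain p r where *: "p \<in> N" "r \<in> carrier R" "x = p \<oplus>\<^bsub>M\<^esub> v \<cdot>\<^bsub>M\<^esub> r"
      by (metis adjoinE)
    then have "x \<cdot>\<^bsub>M\<^esub> a = p \<cdot>\<^bsub>M\<^esub> a \<oplus>\<^bsub>M\<^esub> v \<cdot>\<^bsub>M\<^esub> (r \<otimes> a)"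
      using v a by (simp add: rsmult_l_distr rsmult_closed rsmult_assoc)
    moreover have "p \<cdot>\<^bsub>M\<^esub> a \<oplus>\<^bsub>M\<^esub> v \<cdot>\<^bsub>M\<^esub> (r \<otimes> a) \<in> adjoin N v"
      using * a by (intro adjoinI) auto
    ultimately show "x \<cdot>\<^bsub>M\<^esub> a \<in> adjoin N v" by simp
  qed
qed

section \<open>Homomorphisms, their kernels and their images\<close>

lemma right_homD:
  assumes f: "f \<in> right_hom R M N"
  shows "\<And>x. x \<in> carrier M \<Longrightarrow> f x \<in> carrier N"
    and "\<And>x y. x \<in> carrier M \<Longrightarrow> y \<in> carrier M \<Longrightarrow> f (x \<oplus>\<^bsub>M\<^esub> y) = f x \<oplus>\<^bsub>N\<^esub> f y"
    and "\<And>x a. x \<in> carrier M \<Longrightarrow> a \<in> carrier R \<Longrightarrow> f (x \<cdot>\<^bsub>M\<^esub> a) = f x \<cdot>\<^bsub>N\<^esub> a"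
  using f by (auto simp: right_hom_def)

lemma right_hom_rregD:
  assumes f: "f \<in> right_hom R M (rreg R)"
  shows "\<And>x. x \<in> carrier M \<Longrightarrow> f x \<in> carrier R"
    and "\<And>x y. x \<in> carrier M \<Longrightarrow> y \<in> carrier M \<Longrightarrow> f (x \<oplus>\<^bsub>M\<^esub> y) = f x \<oplus> f y"
    and "\<And>x a. x \<in> carrier M \<Longrightarrow> a \<in> carrier R \<Longrightarrow> f (x \<cdot>\<^bsub>M\<^esub> a) = f x \<otimes> a"
    and "f \<zero>\<^bsub>M\<^esub> = \<zero>"
    and "\<And>x. x \<in> carrier M \<Longrightarrow> f (\<ominus>\<^bsub>M\<^esub> x) = \<ominus> f x"
    and "\<And>x y. x \<in> carrier M \<Longrightarrow> y \<in> carrier M \<Longrightarrow> f (x \<ominus>\<^bsub>M\<^esub> y) = f x \<ominus> f y"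
proof -
  note D = right_homD[OF f, unfolded rreg_def, simplified]
  show "\<And>x. x \<in> carrier M \<Longrightarrow> f x \<in> carrier R"
    and "\<And>x y. x \<in> carrier M \<Longrightarrow> y \<in> carrier M \<Longrightarrow> f (x \<oplus>\<^bsub>M\<^esub> y) = f x \<oplus> f y"
    and "\<And>x a. x \<in> carrier M \<Longrightarrow> a \<in> carrier R \<Longrightarrow> f (x \<cdot>\<^bsub>M\<^esub> a) = f x \<otimes> a"
    using D by auto
  show z: "f \<zero>\<^bsub>M\<^esub> = \<zero>"
    using D(1)[OF M.zero_closed] D(3)[OF M.zero_closed R.zero_closed]
    by (simp add: zero_rsmult)
  show m: "f (\<ominus>\<^bsub>M\<^esub> x) = \<ominus> f x" if x: "x \<in> carrier M" for x
  proof -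
    have "f (\<ominus>\<^bsub>M\<^esub> x) \<oplus> f x = \<zero>"
      using D(2)[of "\<ominus>\<^bsub>M\<^esub> x" x] x z by (simp add: M.l_neg)
    then show ?thesis using x D(1) by (simp add: R.minus_equality)
  qed
  show "f (x \<ominus>\<^bsub>M\<^esub> y) = f x \<ominus> f y" if "x \<in> carrier M" "y \<in> carrier M" for x y
    using that m D by (simp add: M.minus_eq R.minus_eq)
qed

lemma right_submodule_kernel:
  assumes f: "f \<in> right_hom R M (rreg R)"
  shows "right_submodule {x \<in> carrier M. f x = \<zero>} R M"
  using right_hom_rregD[OF f] by (intro right_submoduleI) (auto simp: rsmult_closed)

lemma right_submodule_image:
  assumes N: "right_submodule N R M" and f: "f \<in> right_hom R M (rreg R)"
  shows "right_submodule (f ` N) R (rreg R)"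
proof -
  interpret RR: right_module R "rreg R" by (rule right_module_rreg) (rule R.ring_axioms)
  note [simp] = right_submoduleD[OF N] right_hom_rregD[OF f]
  show "right_submodule (f ` N) R (rreg R)"
  proof (rule RR.right_submoduleI)
    show "f ` N \<subseteq> carrier (rreg R)" by (auto simp: rreg_def)
    have "f \<zero>\<^bsub>M\<^esub> \<in> f ` N" by (intro imageI) simp
    then show "\<zero>\<^bsub>rreg R\<^esub> \<in> f ` N" by (simp add: rreg_def)
  next
    fix r s assume "r \<in> f ` N" "s \<in> f ` N"
    then obtain x y where "x \<in> N" "y \<in> N" "r = f x" "s = f y" by auto
    then show "r \<oplus>\<^bsub>rreg R\<^esub> s \<in> f ` N"
      by (intro image_eqI[of _ _ "x \<oplus>\<^bsub>M\<^esub> y"]) (simp_all add: rreg_def)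
  next
    fix r a assume "r \<in> f ` N" "a \<in> carrier R"
    moreover from this obtain x where "x \<in> N" "r = f x" by auto
    ultimately show "r \<cdot>\<^bsub>rreg R\<^esub> a \<in> f ` N"
      by (intro image_eqI[of _ _ "x \<cdot>\<^bsub>M\<^esub> a"]) (simp_all add: rreg_def)
  qed
qed

text \<open>
  The right ideal \<open>f N\<close> is the domain of the map \<open>f x \<mapsto> g x\<close>, which injectivity realises as a left
  multiplication.
\<close>

lemma right_hom_factor:
  assumes inj: "right_injective TYPE('a set) R (rreg R)"
    and N: "right_submodule N R M"
    and f: "f \<in> right_hom R M (rreg R)" and g: "g \<in> right_hom R M (rreg R)"
    and ker: "\<And>x. x \<in> N \<Longrightarrow> f x = \<zero> \<Longrightarrow> g x = \<zero>"
  obtains q where "q \<in> carrier R" "\<And>x. x \<in> N \<Longrightarrow> g x = q \<otimes> f x"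
proof -
  note D [simp] = right_submoduleD[OF N]
  note fD [simp] = right_hom_rregD[OF f] and gD [simp] = right_hom_rregD[OF g]
  \<comment> \<open>Any preimage of \<open>r\<close> in \<open>N\<close> will do: two of them differ
    by an element of \<open>N\<close> that \<open>f\<close> kills, and by \<open>ker\<close> this is
    killed by \<open>g\<close> too.\<close>
  define \<phi> where "\<phi> r = g (SOME x. x \<in> N \<and> f x = r)" for r
  have phi: "\<phi> (f x) = g x" if x: "x \<in> N" for x
  proof -
    define y where "y = (SOME y. y \<in> N \<and> f y = f x)"
    have y: "y \<in> N" "f y = f x"
      unfolding y_def using x by (metis (mono_tags, lifting) someI)+
    have "f (y \<ominus>\<^bsub>M\<^esub> x) = \<zero>" using x y by (simp add: R.minus_eq R.r_neg)
    then have "g (y \<ominus>\<^bsub>M\<^esub> x) = \<zero>" using ker[of "y \<ominus>\<^bsub>M\<^esub> x"] x y by simp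
    moreover have "(y \<ominus>\<^bsub>M\<^esub> x) \<oplus>\<^bsub>M\<^esub> x = y"
      using x y by (simp add: M.minus_eq M.a_assoc M.l_neg)
    ultimately have "g y = g x"
      using gD(2)[of "y \<ominus>\<^bsub>M\<^esub> x" x] x y by (simp del: gD(2,6))
    then show ?thesis by (simp add: \<phi>_def y_def)
  qed
  have I: "right_submodule (f ` N) R (rreg R)" by (rule right_submodule_image[OF N f])
  have "\<phi> \<in> right_hom R ((rreg R)\<lparr>carrier := f ` N\<rparr>) (rreg R)"
    unfolding right_hom_def
  proof (intro CollectI conjI ballI Pi_I)
    fix r assume "r \<in> carrier ((rreg R)\<lparr>carrier := f ` N\<rparr>)"
    then obtain x where x: "x \<in> N" "r = f x" by auto
    then show "\<phi> r \<in> carrier (rreg R)" by (simp add: phi rreg_def)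
    {
      fix a assume "a \<in> carrier R"
      then show "\<phi> (r \<cdot>\<^bsub>(rreg R)\<lparr>carrier := f ` N\<rparr>\<^esub> a) = \<phi> r \<cdot>\<^bsub>rreg R\<^esub> a"
        using x phi[of "x \<cdot>\<^bsub>M\<^esub> a"] by (simp add: phi rreg_def)
    }
    fix s assume "s \<in> carrier ((rreg R)\<lparr>carrier := f ` N\<rparr>)"
    then obtain y where y: "y \<in> N" "s = f y" by auto
    show "\<phi> (r \<oplus>\<^bsub>(rreg R)\<lparr>carrier := f ` N\<rparr>\<^esub> s) = \<phi> r \<oplus>\<^bsub>rreg R\<^esub> \<phi> s"
      using x y phi[of "x \<oplus>\<^bsub>M\<^esub> y"] by (simp add: phi rreg_def)
  qed
  then obtain q where q: "q \<in> carrier (rreg R)"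
      "\<And>r. r \<in> f ` N \<Longrightarrow> \<phi> r = q \<cdot>\<^bsub>rreg R\<^esub> r"
    using right_injective_ideals[OF inj I] by blast
  show thesis
  proof
    show "q \<in> carrier R" using q(1) by (simp add: rreg_def)
    show "g x = q \<otimes> f x" if "x \<in> N" for x
      using q(2)[of "f x"] phi that by (simp add: rreg_def)
  qed
qed

section \<open>The quotient of a right module by a submodule\<close>

context
  fixes X assumes X: "right_submodule X R M"
begin

interpretation X: abelian_subgroup X M
  using right_submodule.axioms(1)[OF X] M.abelian_group_axioms
  by (intro abelian_subgroupI3 additive_subgroup.intro)

lemma rquot_coset_eq_iff:
  assumes "x \<in> carrier M" "y \<in> carrier M"
  shows "X +>\<^bsub>M\<^esub> x = X +>\<^bsub>M\<^esub> y \<longleftrightarrow> x \<ominus>\<^bsub>M\<^esub> y \<in> X"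
proof -
  have e: "x = (x \<ominus>\<^bsub>M\<^esub> y) \<oplus>\<^bsub>M\<^esub> y"
    using assms by (simp add: M.minus_eq M.a_assoc M.l_neg)
  show ?thesis
  proof
    assume "X +>\<^bsub>M\<^esub> x = X +>\<^bsub>M\<^esub> y"
    then have "x \<in> X +>\<^bsub>M\<^esub> y" using X.a_rcos_self assms by blast
    then obtain h where h: "h \<in> X" "x = h \<oplus>\<^bsub>M\<^esub> y" by (auto simp: a_r_coset_def')
    then have "x \<ominus>\<^bsub>M\<^esub> y = h"
      using assms X.a_subset by (auto simp: M.minus_eq M.a_assoc M.r_neg)
    then show "x \<ominus>\<^bsub>M\<^esub> y \<in> X" using h by simp
  next
    assume "x \<ominus>\<^bsub>M\<^esub> y \<in> X"
    then have "x \<in> X +>\<^bsub>M\<^esub> y" using e by (auto simp: a_r_coset_def')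
    then show "X +>\<^bsub>M\<^esub> x = X +>\<^bsub>M\<^esub> y"
      using M.a_repr_independence[of x X y] assms X.a_subgroup by simp
  qed
qed

lemma carrier_rquot: "carrier (rquot M X) = (\<lambda>x. X +>\<^bsub>M\<^esub> x) ` carrier M"
  by (auto simp: rquot_def A_RCOSETS_def')

lemma add_rquot:
  assumes "x \<in> carrier M" "y \<in> carrier M"
  shows "(X +>\<^bsub>M\<^esub> x) \<oplus>\<^bsub>rquot M X\<^esub> (X +>\<^bsub>M\<^esub> y) = X +>\<^bsub>M\<^esub> (x \<oplus>\<^bsub>M\<^esub> y)"
  using X.a_rcos_sum[OF assms] by (simp add: rquot_def)

lemma zero_rquot: "\<zero>\<^bsub>rquot M X\<^esub> = X +>\<^bsub>M\<^esub> \<zero>\<^bsub>M\<^esub>"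
  using M.a_coset_add_zero[OF X.a_subset] by (simp add: rquot_def)

text \<open>In \<open>rquot\<close> the product is a union over all representatives \<open>c\<close>
  of the coset. Each is \<open>x\<close> plus some \<open>h\<close> in \<open>X\<close>, and
  \<open>h\<close> times \<open>a\<close> stays in \<open>X\<close>, so all members of the union are
  the same coset.\<close>

lemma rsmult_rquot:
  assumes x: "x \<in> carrier M" and a: "a \<in> carrier R"
  shows "(X +>\<^bsub>M\<^esub> x) \<cdot>\<^bsub>rquot M X\<^esub> a = X +>\<^bsub>M\<^esub> (x \<cdot>\<^bsub>M\<^esub> a)"
proof -
  note D = right_submoduleD[OF X]
  have eq: "X +>\<^bsub>M\<^esub> (c \<cdot>\<^bsub>M\<^esub> a) = X +>\<^bsub>M\<^esub> (x \<cdot>\<^bsub>M\<^esub> a)" if c: "c \<in> X +>\<^bsub>M\<^esub> x" for c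
  proof -
    obtain h where h: "h \<in> X" "c = h \<oplus>\<^bsub>M\<^esub> x" using c by (auto simp: a_r_coset_def')
    have "c \<cdot>\<^bsub>M\<^esub> a \<ominus>\<^bsub>M\<^esub> x \<cdot>\<^bsub>M\<^esub> a = h \<cdot>\<^bsub>M\<^esub> a"
      using h x a D by (simp add: rsmult_l_distr M.minus_eq M.a_assoc rsmult_closed M.r_neg)
    then show ?thesis
      using h x a D by (subst rquot_coset_eq_iff) (auto simp: rsmult_closed)
  qed
  have "(X +>\<^bsub>M\<^esub> x) \<cdot>\<^bsub>rquot M X\<^esub> a = (\<Union>c \<in> X +>\<^bsub>M\<^esub> x. X +>\<^bsub>M\<^esub> (c \<cdot>\<^bsub>M\<^esub> a))"
    by (simp add: rquot_def)
  also have "\<dots> = (\<Union>c \<in> X +>\<^bsub>M\<^esub> x. X +>\<^bsub>M\<^esub> (x \<cdot>\<^bsub>M\<^esub> a))"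
    by (rule SUP_cong) (simp_all only: eq)
  also have "\<dots> = X +>\<^bsub>M\<^esub> (x \<cdot>\<^bsub>M\<^esub> a)"
    using X.a_rcos_self[OF x] by (intro UN_constant_eq) auto
  finally show ?thesis .
qed

lemma right_module_rquot: "right_module R (rquot M X)"
proof (intro right_module.intro right_module_axioms.intro abelian_groupI)
  show "ring R" by (rule R.ring_axioms)
  fix C assume "C \<in> carrier (rquot M X)"
  then obtain x where x: "x \<in> carrier M" "C = X +>\<^bsub>M\<^esub> x" by (auto simp: carrier_rquot)
  show "\<exists>D\<in>carrier (rquot M X). D \<oplus>\<^bsub>rquot M X\<^esub> C = \<zero>\<^bsub>rquot M X\<^esub>"
    using x by (intro bexI[of _ "X +>\<^bsub>M\<^esub> (\<ominus>\<^bsub>M\<^esub> x)"])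
      (auto simp: carrier_rquot add_rquot zero_rquot M.l_neg)
qed (auto simp: carrier_rquot add_rquot zero_rquot rsmult_rquot rsmult_closed M.add.m_ac
    rsmult_r_distr rsmult_l_distr rsmult_assoc rsmult_one)

lemma right_hom_rquot: "(\<lambda>x. X +>\<^bsub>M\<^esub> x) \<in> right_hom R M (rquot M X)"
  by (auto simp: right_hom_def carrier_rquot add_rquot rsmult_rquot)

end

end

text \<open>The cogenerator property separates two maps at some point, not at a prescribed one.
  Applied to the identity and the zero map of xR, which is \<open>?N\<close>, it gives a functional
  that is nonzero at some multiple of \<open>x\<close>, hence at \<open>x\<close>. Injectivity
  extends it to \<open>M\<close>.\<close>

lemma cogenerator_separates_zero:
  fixes M :: "('a, 'm) rmodule"
  assumes inj: "right_injective TYPE('m) R (rreg R)" and cog: "right_cogenerator TYPE('m) R (rreg R)"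
    and M: "right_module R M" and x: "x \<in> carrier M" "x \<noteq> \<zero>\<^bsub>M\<^esub>"
  obtains h where "h \<in> right_hom R M (rreg R)" "h x \<noteq> \<zero>\<^bsub>R\<^esub>"
proof -
  interpret M: right_module R M by (rule M)
  let ?z = "{\<zero>\<^bsub>M\<^esub>}"
  let ?N = "M.adjoin ?z x"
  let ?A = "M\<lparr>carrier := ?N\<rparr>"
  have z: "right_submodule ?z R M"
    by (rule M.right_submoduleI) (auto simp: M.zero_rsmult)
  have N: "right_submodule ?N R M" and xN: "x \<in> ?N"
    using M.right_submodule_adjoin[OF z x(1)] M.mem_adjoin[OF z x(1)] by auto
  have A: "right_module R ?A" by (rule right_submodule.right_module_sub[OF N M])
  have "id \<in> right_hom R ?A ?A" by (auto simp: right_hom_def)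
  moreover have "(\<lambda>_. \<zero>\<^bsub>M\<^esub>) \<in> right_hom R ?A ?A"
    using M.right_submoduleD(3)[OF N] by (auto simp: right_hom_def M.zero_rsmult)
  moreover have "\<exists>y\<in>carrier ?A. id y \<noteq> \<zero>\<^bsub>M\<^esub>" using xN x(2) by auto
  ultimately obtain h y where h: "h \<in> right_hom R ?A (rreg R)"
    and y: "y \<in> ?N" "h y \<noteq> h \<zero>\<^bsub>M\<^esub>"
    using cog A unfolding right_cogenerator_def by fastforce
  have "id \<in> right_hom R ?A M"
    using M.right_submoduleD(2)[OF N] by (auto simp: right_hom_def)
  then have "\<exists>g\<in>right_hom R M (rreg R). \<forall>u\<in>carrier ?A. g (id u) = h u"
    using inj A M h unfolding right_injective_def by (metis inj_on_id)
  then obtain g where g: "g \<in> right_hom R M (rreg R)" "\<And>u. u \<in> ?N \<Longrightarrow> g u = h u"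
    by auto
  note gD = M.right_hom_rregD[OF g(1)]
  show thesis
  proof
    show "g \<in> right_hom R M (rreg R)" by (rule g)
    obtain r where r: "r \<in> carrier R" "y = \<zero>\<^bsub>M\<^esub> \<oplus>\<^bsub>M\<^esub> x \<cdot>\<^bsub>M\<^esub> r"
      using y(1) by (auto elim: M.adjoinE)
    have "g y \<noteq> \<zero>\<^bsub>R\<^esub>"
      using y g(2) M.right_submoduleD(3)[OF N] gD(4) by metis
    moreover have "g y = g x \<otimes>\<^bsub>R\<^esub> r"
      using r x gD(3) by (simp add: M.rsmult_closed)
    ultimately show "g x \<noteq> \<zero>\<^bsub>R\<^esub>" using r by auto
  qed
qed

text \<open>The class of \<open>v\<close> modulo \<open>X\<close> is nonzero, and a functional that
  detects it is pulled back along the projection. The quotient lives on the type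
  \<open>'m set\<close>, where \<open>inj_cogenerator_any_type\<close> provides both properties of
  the ring.\<close>

lemma (in right_module) inj_cogenerator_separates:
  assumes R: "inj_cogenerator_ring R" and X: "right_submodule X R M"
    and v: "v \<in> carrier M" "v \<notin> X"
  obtains h where "h \<in> right_hom R M (rreg R)" "\<And>x. x \<in> X \<Longrightarrow> h x = \<zero>" "h v \<noteq> \<zero>"
proof -
  have coset_zero: "X +>\<^bsub>M\<^esub> x = X +>\<^bsub>M\<^esub> \<zero>\<^bsub>M\<^esub> \<longleftrightarrow> x \<in> X" if "x \<in> carrier M" for x
    using rquot_coset_eq_iff[OF X that M.zero_closed] M.add.inv_one that
    by (simp add: M.minus_eq a_inv_def)
  have "X +>\<^bsub>M\<^esub> v \<noteq> \<zero>\<^bsub>rquot M X\<^esub>"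
    using v coset_zero by (simp add: zero_rquot[OF X])
  then obtain h where h: "h \<in> right_hom R (rquot M X) (rreg R)" "h (X +>\<^bsub>M\<^esub> v) \<noteq> \<zero>"
    using cogenerator_separates_zero[OF inj_cogenerator_any_type[OF R] right_module_rquot[OF X]]
      v carrier_rquot[OF X] by blast
  let ?g = "h \<circ> (\<lambda>x. X +>\<^bsub>M\<^esub> x)"
  have g: "?g \<in> right_hom R M (rreg R)"
    by (rule right_hom_comp[OF right_hom_rquot[OF X] h(1)])
  show thesis
  proof
    show "?g \<in> right_hom R M (rreg R)" by (rule g)
    show "?g v \<noteq> \<zero>" using h(2) by simp
    show "?g x = \<zero>" if x: "x \<in> X" for x
    proof -
      have "X +>\<^bsub>M\<^esub> x = X +>\<^bsub>M\<^esub> \<zero>\<^bsub>M\<^esub>"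
        using x coset_zero right_submoduleD(2)[OF X] by simp
      then show ?thesis using right_hom_rregD(4)[OF g] by simp
    qed
  qed
qed

section \<open>Noetherian self-injective rings\<close>

text \<open>Zorn's lemma applies to every nonempty family \<open>C\<close> of submodules: the union
  of a chain in \<open>C\<close> is finitely generated, its generators already lie in one member, so
  the union is that member and belongs to \<open>C\<close>.\<close>

lemma (in right_module) right_noetherian_maximal:
  assumes noeth: "right_noetherian R M" and C: "N\<^sub>0 \<in> C"
    and sub: "\<And>N. N \<in> C \<Longrightarrow> right_submodule N R M"
  shows "\<exists>N\<in>C. \<forall>L\<in>C. N \<subseteq> L \<longrightarrow> L = N"
proof -
  have "\<Union>D \<in> C" if D: "D \<noteq> {}" "subset.chain C D" for D
  proof -
    have DC: "D \<subseteq> C" and tot: "\<And>N L. N \<in> D \<Longrightarrow> L \<in> D \<Longrightarrow> N \<subseteq> L \<or> L \<subseteq> N"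
      using D(2) by (auto simp: subset_chain_def)
    have D_sub: "right_submodule N R M" if "N \<in> D" for N using that DC sub by blast
    have "right_submodule (\<Union>D) R M"
    proof (rule right_submoduleI)
      show "\<Union>D \<subseteq> carrier M" "\<zero>\<^bsub>M\<^esub> \<in> \<Union>D"
        using D(1) right_submoduleD(2,3)[OF D_sub] by blast+
      show "x \<oplus>\<^bsub>M\<^esub> y \<in> \<Union>D" if xy: "x \<in> \<Union>D" "y \<in> \<Union>D" for x y
      proof -
        obtain N where "N \<in> D" "x \<in> N" "y \<in> N" using xy tot by blast
        then show ?thesis using right_submoduleD(4)[OF D_sub] by blast
      qed
      show "x \<cdot>\<^bsub>M\<^esub> a \<in> \<Union>D" if "x \<in> \<Union>D" "a \<in> carrier R" for x a
        using that right_submoduleD(7)[OF D_sub] by blast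
    qed
    then have "right_fin_gen R M (\<Union>D)"
      using noeth by (simp add: right_noetherian_def)
    then obtain S where S: "finite S" "\<Union>D = right_span R M S"
      by (auto simp: right_fin_gen_def)
    have "S \<subseteq> \<Union>D" unfolding S(2) right_span_def by blast
    then obtain N where N: "N \<in> D" "S \<subseteq> N"
      using finite_subset_Union_chain[OF S(1) _ D] by blast
    then have "\<Union>D \<subseteq> N" using D_sub unfolding S(2) right_span_def by blast
    then have "\<Union>D = N" using N(1) by blast
    then show ?thesis using N(1) DC by blast
  qed
  then show ?thesis
    using subset_Zorn_nonempty[of C] C by blast
qed

section \<open>Annihilators and singular elements\<close>

context ring
begin

interpretation RR: right_module R "rreg R"
  by (rule right_module_rreg) (rule ring_axioms)

lemma rreg_simps [simp]:
  "carrier (rreg R) = carrier R" "\<zero>\<^bsub>rreg R\<^esub> = \<zero>" "x \<oplus>\<^bsub>rreg R\<^esub> y = x \<oplus> y" "x \<cdot>\<^bsub>rreg R\<^esub> y = x \<otimes> y"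
  by (simp_all add: rreg_def)

lemma right_hom_left_mult:
  "p \<in> carrier R \<Longrightarrow> (\<lambda>s. p \<otimes> s) \<in> right_hom R (rreg R) (rreg R)"
  by (auto simp: right_hom_def r_distr m_assoc)

definition right_annihilator :: "'a \<Rightarrow> 'a set"
  where "right_annihilator p = {s \<in> carrier R. p \<otimes> s = \<zero>}"

lemma right_submodule_right_annihilator:
  "p \<in> carrier R \<Longrightarrow> right_submodule (right_annihilator p) R (rreg R)"
  using RR.right_submodule_kernel[OF right_hom_left_mult] by (simp add: right_annihilator_def)

lemma right_annihilator_maximal:
  assumes noeth: "right_noetherian R (rreg R)" and A: "A \<subseteq> carrier R" "A \<noteq> {}"
  obtains t where "t \<in> A"
    "\<And>y. y \<in> A \<Longrightarrow> right_annihilator t \<subseteq> right_annihilator y \<Longrightarrow> right_annihilator y = right_annihilator t"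
proof -
  obtain t\<^sub>0 where t0: "t\<^sub>0 \<in> A" using A(2) by blast
  have "\<exists>N\<in>right_annihilator ` A. \<forall>L\<in>right_annihilator ` A. N \<subseteq> L \<longrightarrow> L = N"
    by (rule RR.right_noetherian_maximal[OF noeth, of "right_annihilator t\<^sub>0"])
      (use t0 A(1) right_submodule_right_annihilator in auto)
  then show thesis using that by blast
qed

text \<open>The inclusion makes the map from \<open>p \<otimes> s\<close> to
  \<open>q \<otimes> s\<close> well defined on pR. Injectivity realises it as left multiplication by
  some \<open>c\<close>, and \<open>s = \<one>\<close> gives the equation.\<close>

lemma left_divides_if_right_annihilator_subset:
  assumes inj: "right_injective TYPE('a set) R (rreg R)"
    and pq: "p \<in> carrier R" "q \<in> carrier R" and sub: "right_annihilator p \<subseteq> right_annihilator q"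
  obtains c where "c \<in> carrier R" "q = c \<otimes> p"
proof -
  obtain c where c: "c \<in> carrier R" "\<And>s. s \<in> carrier R \<Longrightarrow> q \<otimes> s = c \<otimes> (p \<otimes> s)"
    using RR.right_hom_factor[OF inj RR.right_submodule_carrier
        right_hom_left_mult[OF pq(1)] right_hom_left_mult[OF pq(2)]] sub
    unfolding right_annihilator_def by (metis (mono_tags, lifting) mem_Collect_eq rreg_simps(1) subsetD)
  show thesis
    using that[OF c(1)] c(2)[OF one_closed] pq by simp
qed

text \<open>The elements with essential right annihilator, tested on principal right ideals.\<close>

definition right_singular :: "'a set"
  where "right_singular = {z \<in> carrier R. \<forall>b\<in>carrier R. b \<noteq> \<zero> \<longrightarrow>
    (\<exists>s\<in>carrier R. b \<otimes> s \<noteq> \<zero> \<and> z \<otimes> (b \<otimes> s) = \<zero>)}"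

text \<open>Single products, not the ideal power that they generate. Nilpotency of \<open>Z\<close>
  reads \<open>set_pow Z n \<subseteq> {\<zero>}\<close>.\<close>

primrec set_pow :: "'a set \<Rightarrow> nat \<Rightarrow> 'a set"
  where "set_pow Z 0 = {\<one>}"
  | "set_pow Z (Suc n) = {p \<otimes> z | p z. p \<in> set_pow Z n \<and> z \<in> Z}"

lemma set_pow_carrier: "Z \<subseteq> carrier R \<Longrightarrow> set_pow Z n \<subseteq> carrier R"
  by (induction n) auto

text \<open>While \<open>set_pow\<close> appends factors on the right, the ascent of the
  annihilators in \<open>right_singular_nilpotent\<close> needs the leftmost factor split
  off.\<close>

lemma set_pow_Suc_left:
  assumes Z: "Z \<subseteq> carrier R" and p: "p \<in> set_pow Z (Suc n)"
  shows "\<exists>z\<in>Z. \<exists>q\<in>set_pow Z n. p = z \<otimes> q"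
  using p
proof (induction n arbitrary: p)
  case 0
  then obtain z where z: "z \<in> Z" "p = \<one> \<otimes> z" by auto
  then have "p = z \<otimes> \<one>" using Z by auto
  then show ?case using z(1) by auto
next
  case (Suc n)
  then obtain q z where q: "q \<in> set_pow Z (Suc n)" "z \<in> Z" "p = q \<otimes> z" by auto
  obtain z' q' where q': "z' \<in> Z" "q' \<in> set_pow Z n" "q = z' \<otimes> q'" using Suc.IH[OF q(1)] by auto
  have "p = z' \<otimes> (q' \<otimes> z)"
    using q q' Z set_pow_carrier[OF Z] by (simp add: m_assoc subset_iff)
  then show ?case using q q' by auto
qed

text \<open>The right annihilators \<open>A n\<close> of the products of length \<open>n\<close>
  ascend, so \<open>A (Suc n) = A n\<close> for some \<open>n\<close>. If this were not all of
  \<open>R\<close>, an element \<open>a\<close> outside it with maximal right annihilator would be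
  sent into \<open>A n\<close> by every \<open>z\<close> in \<open>?Z\<close> and so lie in
  \<open>A (Suc n)\<close>, a contradiction. With \<open>\<one>\<close> in \<open>A n\<close> all
  products of length \<open>n\<close> vanish.\<close>

lemma right_singular_nilpotent:
  assumes noeth: "right_noetherian R (rreg R)"
  obtains n where "set_pow right_singular n \<subseteq> {\<zero>}"
proof -
  let ?Z = right_singular
  have Z: "?Z \<subseteq> carrier R" by (auto simp: right_singular_def)
  have ZD: "\<exists>s\<in>carrier R. b \<otimes> s \<noteq> \<zero> \<and> z \<otimes> (b \<otimes> s) = \<zero>"
    if "z \<in> ?Z" "b \<in> carrier R" "b \<noteq> \<zero>" for z b
    using that by (auto simp: right_singular_def)
  note P = set_pow_carrier[OF Z, THEN subsetD]
  define A where "A n = {a \<in> carrier R. \<forall>p\<in>set_pow ?Z n. p \<otimes> a = \<zero>}" for n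
  have A: "right_submodule (A n) R (rreg R)" for n
    by (rule RR.right_submoduleI) (auto simp: A_def P r_distr m_assoc[symmetric])
  have mono: "A n \<subseteq> A (Suc n)" for n
  proof
    fix a assume a: "a \<in> A n"
    have "p \<otimes> a = \<zero>" if p: "p \<in> set_pow ?Z (Suc n)" for p
    proof -
      obtain z q where "z \<in> ?Z" "q \<in> set_pow ?Z n" "p = z \<otimes> q"
        using set_pow_Suc_left[OF Z p] by blast
      then show ?thesis using a P Z by (auto simp: A_def m_assoc subset_iff)
    qed
    then show "a \<in> A (Suc n)" using a by (auto simp: A_def)
  qed
  have "\<exists>N\<in>range A. \<forall>L\<in>range A. N \<subseteq> L \<longrightarrow> L = N"
    by (rule RR.right_noetherian_maximal[OF noeth, of "A 0"]) (use A in auto)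
  then obtain n where "\<forall>L\<in>range A. A n \<subseteq> L \<longrightarrow> L = A n" by auto
  then have n: "A (Suc n) = A n" using mono[of n] by simp
  have "carrier R \<subseteq> A n"
  proof (rule ccontr)
    assume "\<not> carrier R \<subseteq> A n"
    then obtain a where a: "a \<in> carrier R - A n" and max: "\<And>y. y \<in> carrier R - A n \<Longrightarrow>
        right_annihilator a \<subseteq> right_annihilator y \<Longrightarrow> right_annihilator y = right_annihilator a"
      using right_annihilator_maximal[OF noeth, of "carrier R - A n"] by blast
    have a0: "a \<noteq> \<zero>" using a RR.right_submoduleD(3)[OF A] by auto
    \<comment> \<open>The right annihilator of \<open>z\<close> is essential, so it contains some
      \<open>a \<otimes> s \<noteq> \<zero>\<close>. Thus \<open>z \<otimes> a\<close> annihilates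
      strictly more than \<open>a\<close>, and by maximality it cannot lie outside
      \<open>A n\<close>.\<close>
    have za: "z \<otimes> a \<in> A n" if z: "z \<in> ?Z" for z
    proof (rule ccontr)
      assume n: "z \<otimes> a \<notin> A n"
      have zR: "z \<in> carrier R" using z Z by blast
      obtain s where s: "s \<in> carrier R" "a \<otimes> s \<noteq> \<zero>" "z \<otimes> (a \<otimes> s) = \<zero>"
        using ZD[OF z _ a0] a by blast
      have "right_annihilator a \<subseteq> right_annihilator (z \<otimes> a)"
        using a zR by (auto simp: right_annihilator_def m_assoc)
      then have "right_annihilator (z \<otimes> a) = right_annihilator a"
        using max n a zR by blast
      moreover have "s \<in> right_annihilator (z \<otimes> a)"
        using s a zR by (simp add: right_annihilator_def m_assoc)
      ultimately show False using s by (simp add: right_annihilator_def)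
    qed
    have "a \<in> A (Suc n)"
      using za a Z P by (auto simp: A_def m_assoc subset_iff)
    then show False using n a by simp
  qed
  then have "\<one> \<in> A n" by auto
  then have "p = \<zero>" if "p \<in> set_pow ?Z n" for p
    using that P by (fastforce simp: A_def)
  then show thesis using that by blast
qed

text \<open>The simple submodule of \<open>R / J\<close> is the one generated by the class of \<open>x\<close>.\<close>

lemma cyclic_module_has_simple_submodule:
  assumes inj: "right_injective TYPE('a set) R (rreg R)"
    and noeth: "right_noetherian R (rreg R)"
    and J: "right_submodule J R (rreg R)" and J1: "\<one> \<notin> J"
  obtains x where "x \<in> carrier R" "x \<notin> J"
    "\<And>a. a \<in> carrier R \<Longrightarrow> x \<otimes> a \<notin> J \<Longrightarrow> \<exists>c\<in>carrier R. x \<ominus> x \<otimes> (a \<otimes> c) \<in> J"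
proof -
  let ?Z = right_singular
  note JD = RR.right_submoduleD[OF J, simplified]
  have Z: "?Z \<subseteq> carrier R" by (auto simp: right_singular_def)
  note P = set_pow_carrier[OF Z, THEN subsetD]
  \<comment> \<open>Otherwise every element outside \<open>J\<close> stays outside \<open>J\<close>
    after multiplication by a suitable \<open>z\<close> in \<open>?Z\<close>. Starting from
    \<open>\<one>\<close>, this gives nonzero products of every length, against nilpotency.\<close>
  have "\<exists>p\<in>carrier R - J. \<forall>z\<in>?Z. p \<otimes> z \<in> J"
  proof (rule ccontr)
    assume neg: "\<not> ?thesis"
    have ex: "\<exists>p\<in>set_pow ?Z n. p \<notin> J" for n
    proof (induction n)
      case 0
      then show ?case using J1 by simp
    next
      case (Suc n)
      then obtain p where p: "p \<in> set_pow ?Z n" "p \<notin> J" by blast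
      then obtain z where "z \<in> ?Z" "p \<otimes> z \<notin> J" using neg P by blast
      then show ?case using p(1) by auto
    qed
    obtain n where "set_pow ?Z n \<subseteq> {\<zero>}" by (rule right_singular_nilpotent[OF noeth])
    then show False using ex[of n] JD(3) by auto
  qed
  then obtain p where p: "p \<in> carrier R" "p \<notin> J" "\<And>z. z \<in> ?Z \<Longrightarrow> p \<otimes> z \<in> J" by blast
  let ?A = "{t \<in> carrier R. p \<otimes> t \<notin> J}"
  have "\<one> \<in> ?A" using p by simp
  then obtain t where t: "t \<in> ?A" and max: "\<And>y. y \<in> ?A \<Longrightarrow>
      right_annihilator t \<subseteq> right_annihilator y \<Longrightarrow> right_annihilator y = right_annihilator t"
    using right_annihilator_maximal[OF noeth, of ?A] by blast
  have tR: "t \<in> carrier R" using t by simp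
  show thesis
  proof
    show "p \<otimes> t \<in> carrier R" "p \<otimes> t \<notin> J" using t p by auto
    fix a assume a: "a \<in> carrier R" and pta: "p \<otimes> t \<otimes> a \<notin> J"
    have "t \<otimes> a \<notin> ?Z" using p(3)[of "t \<otimes> a"] pta p(1) a tR by (auto simp: m_assoc)
    \<comment> \<open>The right annihilator of \<open>t \<otimes> a\<close> is not essential, so
      left multiplication by \<open>t \<otimes> a\<close> is injective on some nonzero bR.\<close>
    then obtain b where b: "b \<in> carrier R" "b \<noteq> \<zero>"
      "\<And>s. s \<in> carrier R \<Longrightarrow> t \<otimes> a \<otimes> (b \<otimes> s) = \<zero> \<Longrightarrow> b \<otimes> s = \<zero>"
      using a tR by (auto simp: right_singular_def)
    then have "right_annihilator (t \<otimes> a \<otimes> b) \<subseteq> right_annihilator b"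
      using a tR by (auto simp: right_annihilator_def m_assoc)
    then obtain c where c: "c \<in> carrier R" "b = c \<otimes> (t \<otimes> a \<otimes> b)"
      using left_divides_if_right_annihilator_subset[OF inj, of "t \<otimes> a \<otimes> b" b] a b(1) tR by auto
    \<comment> \<open>By the choice of \<open>c\<close>, \<open>?y\<close> kills
      \<open>a \<otimes> b\<close>, which \<open>t\<close> does not, and it kills all that
      \<open>t\<close> kills. Maximality of \<open>t\<close> puts \<open>p \<otimes> ?y\<close> into
      \<open>J\<close>, which is the claim with witness \<open>c \<otimes> t\<close>.\<close>
    let ?y = "t \<ominus> t \<otimes> a \<otimes> c \<otimes> t"
    have yR: "?y \<in> carrier R" using tR a c by simp
    have y: "?y \<otimes> s = t \<otimes> s \<ominus> t \<otimes> a \<otimes> (c \<otimes> (t \<otimes> s))" if "s \<in> carrier R" for s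
      using that tR a c(1) by (simp add: minus_eq l_distr l_minus m_assoc)
    have "?y \<otimes> (a \<otimes> b) = t \<otimes> (a \<otimes> b) \<ominus> t \<otimes> a \<otimes> b"
      using y[of "a \<otimes> b"] c(2) a b(1) tR c(1) by (simp add: m_assoc)
    also have "\<dots> = \<zero>" using a b(1) tR by (simp add: m_assoc minus_eq r_neg)
    finally have "a \<otimes> b \<in> right_annihilator ?y" using a b(1) by (simp add: right_annihilator_def)
    moreover have "a \<otimes> b \<notin> right_annihilator t"
      using c a b(1,2) tR by (auto simp: right_annihilator_def m_assoc)
    moreover have "right_annihilator t \<subseteq> right_annihilator ?y"
      using y tR a c(1) by (auto simp: right_annihilator_def minus_eq)
    ultimately have "?y \<notin> ?A" using max by blast
    then have "p \<otimes> ?y \<in> J" using yR by simp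
    moreover have "p \<otimes> ?y = p \<otimes> t \<ominus> p \<otimes> t \<otimes> (a \<otimes> (c \<otimes> t))"
      using p(1) tR a c(1) by (simp add: minus_eq r_distr r_minus m_assoc)
    ultimately show "\<exists>c\<in>carrier R. p \<otimes> t \<ominus> p \<otimes> t \<otimes> (a \<otimes> c) \<in> J"
      using c(1) tR by (intro bexI[of _ "c \<otimes> t"]) auto
  qed
qed

end

section \<open>Orthogonality\<close>

lemma (in left_module) submoduleI:
  assumes N: "N \<subseteq> carrier M" "\<zero>\<^bsub>M\<^esub> \<in> N"
    and add: "\<And>x y. x \<in> N \<Longrightarrow> y \<in> N \<Longrightarrow> x \<oplus>\<^bsub>M\<^esub> y \<in> N"
    and smult: "\<And>a x. a \<in> carrier R \<Longrightarrow> x \<in> N \<Longrightarrow> a \<odot>\<^bsub>M\<^esub> x \<in> N"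
  shows "submodule N R M"
proof (intro submodule.intro subgroup.intro submodule_axioms.intro)
  fix x assume x: "x \<in> N"
  then have xM: "x \<in> carrier M" using N by auto
  have "\<zero> \<odot>\<^bsub>M\<^esub> x \<oplus>\<^bsub>M\<^esub> \<zero> \<odot>\<^bsub>M\<^esub> x = \<zero> \<odot>\<^bsub>M\<^esub> x"
    using smult_l_distr[OF R.zero_closed R.zero_closed xM] by simp
  then have "\<zero> \<odot>\<^bsub>M\<^esub> x = \<zero>\<^bsub>M\<^esub>"
    using smult_closed[OF R.zero_closed xM] by (metis M.add.r_cancel_one')
  then have "(\<ominus> \<one>) \<odot>\<^bsub>M\<^esub> x \<oplus>\<^bsub>M\<^esub> x = \<zero>\<^bsub>M\<^esub>"
    using smult_l_distr[of "\<ominus> \<one>" "\<one>" x] xM by (simp add: R.l_neg smult_one)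
  then have "\<ominus>\<^bsub>M\<^esub> x = (\<ominus> \<one>) \<odot>\<^bsub>M\<^esub> x"
    using xM by (simp add: M.minus_equality smult_closed)
  then show "inv\<^bsub>add_monoid M\<^esub> x \<in> N"
    using smult[of "\<ominus> \<one>" x] x by (simp add: a_inv_def)
qed (use assms in auto)

lemma (in left_module) submoduleD:
  assumes N: "submodule N R M"
  shows "N \<subseteq> carrier M" "\<And>x. x \<in> N \<Longrightarrow> x \<in> carrier M" "\<zero>\<^bsub>M\<^esub> \<in> N"
    and "\<And>x y. x \<in> N \<Longrightarrow> y \<in> N \<Longrightarrow> x \<oplus>\<^bsub>M\<^esub> y \<in> N"
    and "\<And>a x. a \<in> carrier R \<Longrightarrow> x \<in> N \<Longrightarrow> a \<odot>\<^bsub>M\<^esub> x \<in> N"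
proof -
  interpret N: submodule N R M by (rule N)
  show "N \<subseteq> carrier M" "\<And>x. x \<in> N \<Longrightarrow> x \<in> carrier M" using N.subset by auto
  show "\<zero>\<^bsub>M\<^esub> \<in> N" using N.one_closed by simp
  show "\<And>x y. x \<in> N \<Longrightarrow> y \<in> N \<Longrightarrow> x \<oplus>\<^bsub>M\<^esub> y \<in> N" using N.m_closed by simp
  show "\<And>a x. a \<in> carrier R \<Longrightarrow> x \<in> N \<Longrightarrow> a \<odot>\<^bsub>M\<^esub> x \<in> N" by (rule N.smult_closed)
qed

lemma (in left_module) submodule_left_span:
  assumes "S \<subseteq> carrier M"
  shows "submodule (left_span R M S) R M"
proof (rule submoduleI)
  have "submodule (carrier M) R M" by (rule submoduleI) (auto simp: smult_closed)
  then show "left_span R M S \<subseteq> carrier M" using assms unfolding left_span_def by blast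
qed (use submoduleD in \<open>auto simp: left_span_def\<close>)

section \<open>The form of a pairing and its orthogonals\<close>

context left_pairing
begin

lemma kappa_right_hom:
  assumes w: "w \<in> carrier W" shows "(\<lambda>v. \<kappa> v w) \<in> right_hom R V (rreg R)"
proof -
  have c: "\<kappa> v \<in> left_hom R W (lreg R)" if "v \<in> carrier V" for v
    using kappa_hom that by (auto simp: right_hom_def ldual_def)
  have "\<kappa> v w \<in> carrier R" if "v \<in> carrier V" for v
    using c[OF that] w by (auto simp: left_hom_def lreg_def)
  moreover have "\<kappa> (x \<oplus>\<^bsub>V\<^esub> y) w = \<kappa> x w \<oplus> \<kappa> y w" if "x \<in> carrier V" "y \<in> carrier V" for x y
    using kappa_hom that w by (simp add: right_hom_def ldual_def)
  moreover have "\<kappa> (x \<cdot>\<^bsub>V\<^esub> a) w = \<kappa> x w \<otimes> a" if "x \<in> carrier V" "a \<in> carrier R" for x a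
    using kappa_hom that w by (simp add: right_hom_def ldual_def)
  ultimately show ?thesis by (simp add: right_hom_def rreg_def)
qed

lemma kappa_left_hom:
  assumes "v \<in> carrier V"
  shows "\<And>w w'. w \<in> carrier W \<Longrightarrow> w' \<in> carrier W \<Longrightarrow> \<kappa> v (w \<oplus>\<^bsub>W\<^esub> w') = \<kappa> v w \<oplus> \<kappa> v w'"
    and "\<And>a w. a \<in> carrier R \<Longrightarrow> w \<in> carrier W \<Longrightarrow> \<kappa> v (a \<odot>\<^bsub>W\<^esub> w) = a \<otimes> \<kappa> v w"
    and "\<kappa> v \<zero>\<^bsub>W\<^esub> = \<zero>"
proof -
  have "\<kappa> v \<in> left_hom R W (lreg R)"
    using kappa_hom assms by (auto simp: right_hom_def ldual_def)
  then show add: "\<And>w w'. w \<in> carrier W \<Longrightarrow> w' \<in> carrier W \<Longrightarrow> \<kappa> v (w \<oplus>\<^bsub>W\<^esub> w') = \<kappa> v w \<oplus> \<kappa> v w'"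
    and "\<And>a w. a \<in> carrier R \<Longrightarrow> w \<in> carrier W \<Longrightarrow> \<kappa> v (a \<odot>\<^bsub>W\<^esub> w) = a \<otimes> \<kappa> v w"
    by (simp_all add: left_hom_def lreg_def)
  have "\<kappa> v \<zero>\<^bsub>W\<^esub> \<in> carrier R"
    by (rule V.right_hom_rregD(1)[OF kappa_right_hom]) (simp_all add: assms)
  then show "\<kappa> v \<zero>\<^bsub>W\<^esub> = \<zero>"
    using add[of "\<zero>\<^bsub>W\<^esub>" "\<zero>\<^bsub>W\<^esub>"] by (simp add: V.R.add.r_cancel_one')
qed

lemmas kappa_simps = V.right_hom_rregD[OF kappa_right_hom]

abbreviation perp_W where "perp_W \<equiv> perp_right R W \<kappa>"
abbreviation perp_V where "perp_V \<equiv> perp_left R V \<kappa>"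

lemma right_submodule_perp_left:
  assumes "K \<subseteq> carrier W" shows "right_submodule (perp_V K) R V"
  using assms kappa_simps
  by (intro V.right_submoduleI) (auto simp: perp_left_def V.rsmult_closed subset_iff)

lemma submodule_perp_right:
  assumes "X \<subseteq> carrier V" shows "submodule (perp_W X) R W"
  using assms kappa_left_hom
  by (intro W.submoduleI) (auto simp: perp_right_def W.smult_closed subset_iff)

text \<open>The double orthogonal \<open>perp_W (perp_V F)\<close> is a submodule containing
  \<open>F\<close>, hence contains the span. This exchanges finite sets and finitely generated
  submodules in the description of the open submodules.\<close>

lemma perp_left_left_span:
  assumes "F \<subseteq> carrier W" shows "perp_V (left_span R W F) = perp_V F"
proof
  show "perp_V (left_span R W F) \<subseteq> perp_V F"
    unfolding perp_left_def left_span_def by blast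
  have "left_span R W F \<subseteq> perp_W (perp_V F)"
    using submodule_perp_right[of "perp_V F"] assms
    unfolding left_span_def by (intro Inter_lower) (auto simp: perp_left_def perp_right_def)
  then show "perp_V F \<subseteq> perp_V (left_span R W F)"
    by (auto simp: perp_left_def perp_right_def)
qed

text \<open>
  Induction on \<open>F\<close>: on \<open>F\<^sup>\<bottom>\<close> the map \<open>g\<close> factors through \<open>\<langle>-, w\<rangle>\<close> as \<open>q \<langle>-, w\<rangle>\<close>,
  and \<open>g - q \<langle>-, w\<rangle>\<close> vanishes on \<open>F\<^sup>\<bottom>\<close>.
\<close>

lemma represented_if_vanishes_on_finite_perp:
  assumes inj: "right_injective TYPE('a set) R (rreg R)"
    and F: "finite F" "F \<subseteq> K" and K: "submodule K R W"
    and g: "g \<in> right_hom R V (rreg R)" "\<And>v. v \<in> perp_V F \<Longrightarrow> g v = \<zero>"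
  obtains w where "w \<in> K" "\<And>v. v \<in> carrier V \<Longrightarrow> g v = \<kappa> v w"
proof -
  note KD = W.submoduleD[OF K]
  have "\<exists>w\<in>K. \<forall>v\<in>carrier V. g v = \<kappa> v w"
    using F g
  proof (induction F arbitrary: g rule: finite_induct)
    case empty
    then have "g v = \<kappa> v \<zero>\<^bsub>W\<^esub>" if "v \<in> carrier V" for v
      using that by (simp add: perp_left_def kappa_left_hom)
    then show ?case using KD(3) by blast
  next
    case (insert w F)
    have w: "w \<in> K" "w \<in> carrier W" and F: "F \<subseteq> K" "F \<subseteq> carrier W"
      using insert.prems(1) KD by auto
    note kw = kappa_simps[OF w(2)] and gD = V.right_hom_rregD[OF insert.prems(2)]
    have "g v = \<zero>" if "v \<in> perp_V F" "\<kappa> v w = \<zero>" for v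
      using that insert.prems(3) by (auto simp: perp_left_def)
    then obtain q where q: "q \<in> carrier R" "\<And>v. v \<in> perp_V F \<Longrightarrow> g v = q \<otimes> \<kappa> v w"
      using V.right_hom_factor[OF inj right_submodule_perp_left[OF F(2)]
          kappa_right_hom[OF w(2)] insert.prems(2)] by blast
    let ?h = "\<lambda>v. g v \<ominus> q \<otimes> \<kappa> v w"
    have "?h \<in> right_hom R V (rreg R)"
      using q(1) kw gD
      by (auto simp: right_hom_def rreg_def V.R.minus_eq V.R.r_distr V.R.l_distr V.R.minus_add
          V.R.m_assoc V.R.l_minus V.R.add.m_ac)
    moreover have "?h v = \<zero>" if "v \<in> perp_V F" for v
      using that q kw(1)[of v] by (simp add: perp_left_def V.R.minus_eq V.R.r_neg)
    ultimately obtain u where u: "u \<in> K" "\<And>v. v \<in> carrier V \<Longrightarrow> ?h v = \<kappa> v u"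
      using insert.IH[OF F(1), of ?h] by blast
    have "g v = \<kappa> v (u \<oplus>\<^bsub>W\<^esub> q \<odot>\<^bsub>W\<^esub> w)" if v: "v \<in> carrier V" for v
    proof -
      have "g v = ?h v \<oplus> q \<otimes> \<kappa> v w"
        using v q(1) kw(1) gD(1) by (simp add: V.R.minus_eq V.R.a_assoc V.R.l_neg)
      then show ?thesis
        using u v q(1) w KD(2) by (simp add: kappa_left_hom W.smult_closed)
    qed
    \<comment> \<open>The representing element is kept in \<open>K\<close>, so that for
      \<open>K = perp_W X\<close> it is orthogonal to \<open>X\<close>.\<close>
    moreover have "u \<oplus>\<^bsub>W\<^esub> q \<odot>\<^bsub>W\<^esub> w \<in> K" by (intro KD(4,5) u(1) q(1) w(1))
    ultimately show ?case by blast
  qed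
  then show thesis using that by blast
qed

text \<open>By \<open>simple\<close>, the quotient of \<open>V.adjoin L v\<close> by
  \<open>L\<close> is zero or simple. The part of \<open>V.adjoin L v\<close> in
  \<open>perp_V F\<close> meets \<open>L\<close> in \<open>perp_V K\<close>, so modulo
  \<open>perp_V K\<close> it embeds there and is zero or simple as well. If it is simple, some
  \<open>w\<close> in \<open>K\<close> does not vanish on it and cuts out a proper submodule, which
  is then \<open>perp_V K\<close>.\<close>

lemma simple_extension_finite_perp:
  assumes L: "right_submodule L R V" and v: "v \<in> carrier V"
    and simple: "\<And>a. a \<in> carrier R \<Longrightarrow> v \<cdot>\<^bsub>V\<^esub> a \<notin> L \<Longrightarrow>
      \<exists>c\<in>carrier R. v \<ominus>\<^bsub>V\<^esub> v \<cdot>\<^bsub>V\<^esub> (a \<otimes> c) \<in> L"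
    and K: "K \<subseteq> carrier W" and F: "finite F" "F \<subseteq> K" "perp_V F \<inter> L = perp_V K"
  obtains G where "finite G" "G \<subseteq> K" "perp_V G \<inter> V.adjoin L v = perp_V K"
proof (cases "perp_V F \<inter> V.adjoin L v = perp_V K")
  case True
  then show thesis using that F by blast
next
  case False
  let ?P = "perp_V F \<inter> V.adjoin L v"
  have FW: "F \<subseteq> carrier W" using F K by blast
  note LD = V.right_submoduleD[OF L] and XD = V.right_submoduleD[OF right_submodule_perp_left[OF K]]
    and FD = V.right_submoduleD[OF right_submodule_perp_left[OF FW]]
  have X: "perp_V K \<subseteq> ?P" using F(3) V.subset_adjoin[OF L v] by blast
  have gen: "\<exists>c\<in>carrier R. y \<ominus>\<^bsub>V\<^esub> u \<cdot>\<^bsub>V\<^esub> c \<in> perp_V K"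
    if u: "u \<in> ?P" "u \<notin> perp_V K" and y: "y \<in> ?P" for u y
  proof -
    obtain l a where l: "l \<in> L" "a \<in> carrier R" "u = l \<oplus>\<^bsub>V\<^esub> v \<cdot>\<^bsub>V\<^esub> a"
      using u(1) by (auto elim: V.adjoinE)
    obtain m b where m: "m \<in> L" "b \<in> carrier R" "y = m \<oplus>\<^bsub>V\<^esub> v \<cdot>\<^bsub>V\<^esub> b"
      using y by (auto elim: V.adjoinE)
    \<comment> \<open>Otherwise \<open>u\<close> would lie in \<open>perp_V F \<inter> L\<close>,
      which is \<open>perp_V K\<close>.\<close>
    have "v \<cdot>\<^bsub>V\<^esub> a \<notin> L"
      using u l LD(4) F(3) by blast
    then obtain c where c: "c \<in> carrier R" "v \<ominus>\<^bsub>V\<^esub> v \<cdot>\<^bsub>V\<^esub> (a \<otimes> c) \<in> L"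
      using simple l(2) by blast
    let ?e = "v \<ominus>\<^bsub>V\<^esub> v \<cdot>\<^bsub>V\<^esub> (a \<otimes> c)"
    have cb: "c \<otimes> b \<in> carrier R" using c m by simp
    \<comment> \<open>Modulo \<open>L\<close>, \<open>y\<close> is v b, which is v a c b and hence u
      c b. The difference thus lies in \<open>L\<close>, and also in
      \<open>perp_V F\<close>.\<close>
    have "y \<ominus>\<^bsub>V\<^esub> u \<cdot>\<^bsub>V\<^esub> (c \<otimes> b) = m \<ominus>\<^bsub>V\<^esub> l \<cdot>\<^bsub>V\<^esub> (c \<otimes> b) \<oplus>\<^bsub>V\<^esub> ?e \<cdot>\<^bsub>V\<^esub> b"
      using l m c(1) v LD(2)
      by (simp add: V.M.minus_eq V.rsmult_l_distr V.rsmult_closed V.minus_rsmult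
          V.rsmult_assoc V.M.minus_add V.M.add.m_ac)
    moreover have "m \<ominus>\<^bsub>V\<^esub> l \<cdot>\<^bsub>V\<^esub> (c \<otimes> b) \<oplus>\<^bsub>V\<^esub> ?e \<cdot>\<^bsub>V\<^esub> b \<in> L"
      by (intro LD(4) LD(6) LD(7) l(1) m(1,2) c(2) cb)
    moreover have "y \<ominus>\<^bsub>V\<^esub> u \<cdot>\<^bsub>V\<^esub> (c \<otimes> b) \<in> perp_V F"
      using u(1) y by (intro FD(6) FD(7) cb) auto
    ultimately show ?thesis using cb F(3) by (intro bexI[of _ "c \<otimes> b"]) auto
  qed
  obtain u where u: "u \<in> ?P" "u \<notin> perp_V K" using X False by blast
  then obtain w where w: "w \<in> K" "\<kappa> u w \<noteq> \<zero>" and uV: "u \<in> carrier V"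
    by (auto simp: perp_left_def)
  have wW: "w \<in> carrier W" using w K by blast
  \<comment> \<open>If \<open>y\<close> were outside \<open>perp_V K\<close>, then \<open>u\<close>
    would be a multiple of \<open>y\<close> modulo \<open>perp_V K\<close>, and \<open>w\<close>
    would vanish on \<open>u\<close> as it does on \<open>y\<close>.\<close>
  have "y \<in> perp_V K" if y: "y \<in> ?P" "\<kappa> y w = \<zero>" for y
  proof (rule ccontr)
    assume "y \<notin> perp_V K"
    then obtain c where c: "c \<in> carrier R" "u \<ominus>\<^bsub>V\<^esub> y \<cdot>\<^bsub>V\<^esub> c \<in> perp_V K"
      using gen[OF y(1) _ u(1)] by blast
    have yV: "y \<in> carrier V" using y(1) by (auto simp: perp_left_def)
    have "\<kappa> (u \<ominus>\<^bsub>V\<^esub> y \<cdot>\<^bsub>V\<^esub> c) w = \<zero>" using c(2) w(1) by (auto simp: perp_left_def)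
    then have "\<kappa> u w = \<zero>"
      using uV yV c(1) y(2) kappa_simps[OF wW] by (simp add: V.R.minus_eq V.rsmult_closed)
    then show False using w(2) by simp
  qed
  then have "perp_V (insert w F) \<inter> V.adjoin L v = perp_V K"
    using X w(1) by (auto simp: perp_left_def)
  then show thesis using that[of "insert w F"] F w(1) by blast
qed

text \<open>
  A maximal right ideal among the preimages of those submodules on which finitely many
  elements of \<open>K\<close> suffice must be \<open>R\<close>, since otherwise it has a simple extension.
\<close>

lemma adjoin_finite_perp:
  assumes inj: "right_injective TYPE('a set) R (rreg R)"
    and noeth: "right_noetherian R (rreg R)"
    and K: "K \<subseteq> carrier W" and v: "v \<in> carrier V"
    and L: "right_submodule L R V" and F: "finite F" "F \<subseteq> K" "perp_V F \<inter> L = perp_V K"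
  obtains N G where "right_submodule N R V" "L \<subseteq> N" "v \<in> N" "finite G" "G \<subseteq> K" "perp_V G \<inter> N = perp_V K"
proof -
  interpret RR: right_module R "rreg R" by (rule right_module_rreg) (rule V.R.ring_axioms)
  \<comment> \<open>The chain condition is on \<open>R\<close>, so submodules of \<open>V\<close>
    are compared through right ideals.\<close>
  define pre where "pre N = {r \<in> carrier R. v \<cdot>\<^bsub>V\<^esub> r \<in> N}" for N
  define good where "good N \<longleftrightarrow> right_submodule N R V \<and> L \<subseteq> N \<and>
    (\<exists>G. finite G \<and> G \<subseteq> K \<and> perp_V G \<inter> N = perp_V K)" for N
  have pre: "right_submodule (pre N) R (rreg R)" if N: "right_submodule N R V" for N
    using V.right_submoduleD[OF N] v
    by (intro RR.right_submoduleI)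
      (auto simp: pre_def V.rsmult_zero_right V.rsmult_r_distr V.rsmult_assoc)
  have "good L" using L F by (auto simp: good_def)
  have "\<exists>J\<in>pre ` Collect good. \<forall>I\<in>pre ` Collect good. J \<subseteq> I \<longrightarrow> I = J"
    by (rule RR.right_noetherian_maximal[OF noeth, of "pre L"])
      (use pre \<open>good L\<close> in \<open>auto simp: good_def\<close>)
  then obtain N where N: "good N" and max: "\<And>N'. good N' \<Longrightarrow> pre N \<subseteq> pre N' \<Longrightarrow> pre N' = pre N"
    by auto
  have NR: "right_submodule N R V" using N by (simp add: good_def)
  obtain G where G: "finite G" "G \<subseteq> K" "perp_V G \<inter> N = perp_V K" using N by (auto simp: good_def)
  have "\<one> \<in> pre N"
  proof (rule ccontr)
    assume "\<one> \<notin> pre N"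
    then obtain x where x: "x \<in> carrier R" "x \<notin> pre N"
      and simple: "\<And>a. a \<in> carrier R \<Longrightarrow> x \<otimes> a \<notin> pre N \<Longrightarrow>
        \<exists>c\<in>carrier R. x \<ominus> x \<otimes> (a \<otimes> c) \<in> pre N"
      using V.R.cyclic_module_has_simple_submodule[OF inj noeth pre[OF NR]] by blast
    \<comment> \<open>The quotient of \<open>R\<close> by \<open>pre N\<close> embeds in that of
      \<open>V\<close> by \<open>N\<close>, with \<open>\<one>\<close> going to \<open>v\<close>.
      The simple submodule generated by the class of \<open>x\<close> becomes the one generated by
      the class of \<open>?u\<close>.\<close>
    let ?u = "v \<cdot>\<^bsub>V\<^esub> x"
    have u: "?u \<in> carrier V" using v x by (simp add: V.rsmult_closed)
    have "\<exists>c\<in>carrier R. ?u \<ominus>\<^bsub>V\<^esub> ?u \<cdot>\<^bsub>V\<^esub> (a \<otimes> c) \<in> N"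
      if a: "a \<in> carrier R" "?u \<cdot>\<^bsub>V\<^esub> a \<notin> N" for a
    proof -
      have "x \<otimes> a \<notin> pre N" using a v x by (simp add: pre_def V.rsmult_assoc)
      then obtain c where c: "c \<in> carrier R" "x \<ominus> x \<otimes> (a \<otimes> c) \<in> pre N"
        using simple a(1) by blast
      then have "v \<cdot>\<^bsub>V\<^esub> (x \<ominus> x \<otimes> (a \<otimes> c)) \<in> N" by (simp add: pre_def)
      then show ?thesis
        using a(1) c(1) v x(1)
        by (intro bexI[of _ c]) (simp_all add: V.rsmult_minus_distr V.rsmult_assoc)
    qed
    then obtain G' where G': "finite G'" "G' \<subseteq> K" "perp_V G' \<inter> V.adjoin N ?u = perp_V K"
      using simple_extension_finite_perp[OF NR u _ K G] by blast
    have "good (V.adjoin N ?u)"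
      using G' V.right_submodule_adjoin[OF NR u] V.subset_adjoin[OF NR u] N
      by (auto simp: good_def)
    moreover have "pre N \<subseteq> pre (V.adjoin N ?u)"
      using V.subset_adjoin[OF NR u] by (auto simp: pre_def)
    moreover have "x \<in> pre (V.adjoin N ?u)"
      using V.mem_adjoin[OF NR u] x(1) by (simp add: pre_def)
    ultimately show False using max x(2) by blast
  qed
  then have "v \<in> N" using v by (simp add: pre_def V.rsmult_one)
  then show thesis using that[OF NR _ _ G] N by (simp add: good_def)
qed

text \<open>Assumption \<open>gen\<close> says that \<open>S\<close> generates \<open>V\<close>
  modulo \<open>perp_V K\<close>. Starting from the submodule \<open>perp_V K\<close> and the empty
  subset of \<open>K\<close>, \<open>adjoin_finite_perp\<close> takes in the elements of
  \<open>S\<close> one by one. In the end the submodule is \<open>V\<close>, and the finite subset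
  alone has orthogonal \<open>perp_V K\<close>.\<close>

lemma finite_perp_eq_perp:
  assumes inj: "right_injective TYPE('a set) R (rreg R)"
    and noeth: "right_noetherian R (rreg R)"
    and K: "K \<subseteq> carrier W"
    and S: "finite S" "S \<subseteq> carrier V"
    and gen: "\<And>N. right_submodule N R V \<Longrightarrow> perp_V K \<union> S \<subseteq> N \<Longrightarrow> N = carrier V"
  obtains F where "finite F" "F \<subseteq> K" "perp_V F = perp_V K"
proof -
  have "\<exists>N F. right_submodule N R V \<and> perp_V K \<union> S \<subseteq> N \<and> finite F \<and> F \<subseteq> K \<and> perp_V F \<inter> N = perp_V K"
    using S
  proof (induction S rule: finite_induct)
    case empty
    have "perp_V {} \<inter> perp_V K = perp_V K" by (auto simp: perp_left_def)
    then show ?case using right_submodule_perp_left[OF K] by blast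
  next
    case (insert v S)
    then obtain N F where N: "right_submodule N R V" "perp_V K \<union> S \<subseteq> N"
      and F: "finite F" "F \<subseteq> K" "perp_V F \<inter> N = perp_V K" by auto
    have v: "v \<in> carrier V" using insert.prems by simp
    obtain L G where "right_submodule L R V" "N \<subseteq> L" "v \<in> L" "finite G" "G \<subseteq> K" "perp_V G \<inter> L = perp_V K"
      by (rule adjoin_finite_perp[OF inj noeth K v N(1) F])
    then show ?case using N(2) by (intro exI[of _ L] exI[of _ G]) auto
  qed
  then obtain N F where N: "right_submodule N R V" "perp_V K \<union> S \<subseteq> N"
    and F: "finite F" "F \<subseteq> K" "perp_V F \<inter> N = perp_V K" by blast
  have "N = carrier V" using N by (rule gen)
  then have "perp_V F = perp_V K" using F(3) by (auto simp: perp_left_def)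
  then show thesis using that F by blast
qed

end

text \<open>Generators of the quotient are lifted to \<open>M\<close>, which turns finite generation
  into a condition on submodules of \<open>M\<close>, the form that
  \<open>finite_perp_eq_perp\<close> takes.\<close>

lemma (in right_module) cofinite_submodule_generators:
  assumes X: "cofinite_submodule R M X"
  obtains S where "finite S" "S \<subseteq> carrier M"
    "\<And>N. right_submodule N R M \<Longrightarrow> X \<union> S \<subseteq> N \<Longrightarrow> N = carrier M"
proof -
  have XR: "right_submodule X R M" using X by (simp add: cofinite_submodule_def)
  interpret Q: right_module R "rquot M X" by (rule right_module_rquot[OF XR])
  let ?\<pi> = "\<lambda>x. X +>\<^bsub>M\<^esub> x"
  have "right_fin_gen R (rquot M X) (carrier (rquot M X))"
    using X by (simp add: cofinite_submodule_def)
  then obtain T where T: "T \<subseteq> ?\<pi> ` carrier M" "finite T"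
      and span: "carrier (rquot M X) = right_span R (rquot M X) T"
    unfolding right_fin_gen_def carrier_rquot[OF XR] by blast
  obtain S where S: "S \<subseteq> carrier M" "finite S" "T = ?\<pi> ` S"
    using finite_subset_image[OF T(2,1)] by blast
  show thesis
  proof
    show "finite S" "S \<subseteq> carrier M" by fact+
    fix N assume N: "right_submodule N R M" and sub: "X \<union> S \<subseteq> N"
    note ND = right_submoduleD[OF N]
    have "right_submodule (?\<pi> ` N) R (rquot M X)"
    proof (rule Q.right_submoduleI)
      show "?\<pi> ` N \<subseteq> carrier (rquot M X)" using ND(1) by (auto simp: carrier_rquot[OF XR])
      show "\<zero>\<^bsub>rquot M X\<^esub> \<in> ?\<pi> ` N" using ND(3) by (simp add: zero_rquot[OF XR])
    next
      fix C D assume "C \<in> ?\<pi> ` N" "D \<in> ?\<pi> ` N"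
      then obtain x y where "x \<in> N" "y \<in> N" "C = ?\<pi> x" "D = ?\<pi> y" by blast
      then show "C \<oplus>\<^bsub>rquot M X\<^esub> D \<in> ?\<pi> ` N"
        using ND by (auto simp: add_rquot[OF XR])
    next
      fix C a assume "C \<in> ?\<pi> ` N" "a \<in> carrier R"
      moreover from this obtain x where "x \<in> N" "C = ?\<pi> x" by blast
      ultimately show "C \<cdot>\<^bsub>rquot M X\<^esub> a \<in> ?\<pi> ` N"
        using ND by (auto simp: rsmult_rquot[OF XR])
    qed
    moreover have "T \<subseteq> ?\<pi> ` N" unfolding S(3) using sub by (intro image_mono) auto
    ultimately have all: "carrier (rquot M X) \<subseteq> ?\<pi> ` N"
      unfolding span right_span_def by (intro Inter_lower) simp
    have "v \<in> N" if v: "v \<in> carrier M" for v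
    proof -
      have "?\<pi> v \<in> carrier (rquot M X)" using v by (simp add: carrier_rquot[OF XR])
      then obtain n where n: "n \<in> N" "?\<pi> v = ?\<pi> n" using all by blast
      then have "v \<ominus>\<^bsub>M\<^esub> n \<in> N"
        using rquot_coset_eq_iff[OF XR v ND(2)[OF n(1)]] sub by auto
      then have "(v \<ominus>\<^bsub>M\<^esub> n) \<oplus>\<^bsub>M\<^esub> n \<in> N" using n(1) by (rule ND(4))
      then show ?thesis using v n ND by (simp add: M.minus_eq M.a_assoc M.l_neg)
    qed
    then show "N = carrier M" using ND(1) by blast
  qed
qed

text \<open>Induction on \<open>F\<close>: the values at \<open>w\<close> of the elements of
  \<open>perp_V F\<close> form a right ideal, which is finitely generated. Lifts of its generators
  to \<open>perp_V F\<close>, together with generators of \<open>V\<close> modulo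
  \<open>perp_V F\<close>, generate \<open>V\<close> modulo
  \<open>perp_V (insert w F)\<close>.\<close>

lemma (in left_pairing) finite_perp_generators:
  assumes noeth: "right_noetherian R (rreg R)"
    and F: "finite F" "F \<subseteq> carrier W"
  obtains S where "finite S" "S \<subseteq> carrier V"
    "\<And>N. right_submodule N R V \<Longrightarrow> perp_V F \<union> S \<subseteq> N \<Longrightarrow> N = carrier V"
proof -
  interpret RR: right_module R "rreg R" by (rule right_module_rreg) (rule V.R.ring_axioms)
  have "\<exists>S. finite S \<and> S \<subseteq> carrier V \<and> (\<forall>N. right_submodule N R V \<longrightarrow> perp_V F \<union> S \<subseteq> N \<longrightarrow> N = carrier V)"
    using F
  proof (induction F rule: finite_induct)
    case empty
    have "N = carrier V" if "right_submodule N R V" "perp_V {} \<subseteq> N" for N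
      using that V.right_submoduleD(1)[OF that(1)] by (auto simp: perp_left_def)
    then show ?case by (intro exI[of _ "{}"]) auto
  next
    case (insert w F)
    then obtain S where S: "finite S" "S \<subseteq> carrier V"
      "\<And>N. right_submodule N R V \<Longrightarrow> perp_V F \<union> S \<subseteq> N \<Longrightarrow> N = carrier V" by auto
    have w: "w \<in> carrier W" and FW: "F \<subseteq> carrier W" using insert.prems by auto
    note kw = kappa_simps[OF w] and FD = V.right_submoduleD[OF right_submodule_perp_left[OF FW]]
    let ?f = "\<lambda>v. \<kappa> v w"
    have "right_submodule (?f ` perp_V F) R (rreg R)"
      by (rule V.right_submodule_image[OF right_submodule_perp_left[OF FW] kappa_right_hom[OF w]])
    then have "right_fin_gen R (rreg R) (?f ` perp_V F)"
      using noeth by (simp add: right_noetherian_def)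
    then obtain T where T: "finite T" "?f ` perp_V F = right_span R (rreg R) T"
      by (auto simp: right_fin_gen_def)
    have "T \<subseteq> ?f ` perp_V F" unfolding T(2) right_span_def by blast
    then obtain S' where S': "S' \<subseteq> perp_V F" "finite S'" "T = ?f ` S'"
      using finite_subset_image[OF T(1)] by blast
    have "N = carrier V" if N: "right_submodule N R V" and sub: "perp_V (insert w F) \<union> (S \<union> S') \<subseteq> N" for N
    proof (rule S(3)[OF N])
      let ?N = "N \<inter> perp_V F"
      have NF: "right_submodule ?N R V"
        by (rule V.right_submodule_Int[OF N right_submodule_perp_left[OF FW]])
      note ND = V.right_submoduleD[OF N]
      have "right_submodule (?f ` ?N) R (rreg R)"
        by (rule V.right_submodule_image[OF NF kappa_right_hom[OF w]])
      moreover have "T \<subseteq> ?f ` ?N" unfolding S'(3) using S'(1) sub by (intro image_mono) auto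
      ultimately have all: "?f ` perp_V F \<subseteq> ?f ` ?N"
        unfolding T(2) right_span_def by (intro Inter_lower) simp
      \<comment> \<open>Some \<open>n\<close> in \<open>?N\<close> has the same value at
        \<open>w\<close> as \<open>v\<close>. The difference is orthogonal to
        \<open>insert w F\<close> and hence in \<open>N\<close>.\<close>
      have "v \<in> N" if v: "v \<in> perp_V F" for v
      proof -
        have "\<kappa> v w \<in> ?f ` ?N" using all v by blast
        then obtain n where n: "n \<in> N" "n \<in> perp_V F" "\<kappa> v w = \<kappa> n w" by blast
        have c: "v \<in> carrier V" "n \<in> carrier V" using v n(2) FD(2) by auto
        have "\<kappa> (v \<ominus>\<^bsub>V\<^esub> n) w = \<kappa> n w \<ominus> \<kappa> n w" using kw(6)[OF c] n(3) by simp
        then have "\<kappa> (v \<ominus>\<^bsub>V\<^esub> n) w = \<zero>" using kw(1)[OF c(2)] by (simp add: V.R.minus_eq V.R.r_neg)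
        then have "v \<ominus>\<^bsub>V\<^esub> n \<in> perp_V (insert w F)"
          using FD(6)[OF v n(2)] by (auto simp: perp_left_def)
        then have "(v \<ominus>\<^bsub>V\<^esub> n) \<oplus>\<^bsub>V\<^esub> n \<in> N" using n(1) sub by (intro ND(4)) auto
        then show ?thesis using c by (simp add: V.M.minus_eq V.M.a_assoc V.M.l_neg)
      qed
      then show "perp_V F \<union> S \<subseteq> N" using sub by blast
    qed
    moreover have "S \<union> S' \<subseteq> carrier V" using S(2) S'(1) FD(1) by blast
    ultimately show ?case using S(1) S'(2) by (intro exI[of _ "S \<union> S'"]) auto
  qed
  then show thesis using that by blast
qed

section \<open>Closed and open submodules\<close>

context left_pairing
begin

abbreviation weak where "weak \<equiv> weak_topology R V W \<kappa>"

lemma topspace_weak: "topspace weak = carrier V"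
  by (rule topspace_weak_topology) (rule V.M.abelian_group_axioms)

lemma openin_weak_coset:
  assumes v: "v \<in> carrier V" and F: "finite F" "F \<subseteq> carrier W"
  shows "openin weak ((\<lambda>y. v \<oplus>\<^bsub>V\<^esub> y) ` perp_V F)"
  unfolding openin_weak_topology
proof (intro conjI ballI)
  note FD = V.right_submoduleD[OF right_submodule_perp_left[OF F(2)]]
  show "(\<lambda>y. v \<oplus>\<^bsub>V\<^esub> y) ` perp_V F \<subseteq> carrier V" using v FD by auto
  fix x assume "x \<in> (\<lambda>y. v \<oplus>\<^bsub>V\<^esub> y) ` perp_V F"
  then obtain y where "y \<in> perp_V F" "x = v \<oplus>\<^bsub>V\<^esub> y" by blast
  then have "x \<oplus>\<^bsub>V\<^esub> z \<in> (\<lambda>y. v \<oplus>\<^bsub>V\<^esub> y) ` perp_V F" if "z \<in> perp_V F" for z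
    using that v FD by (intro image_eqI[of _ _ "y \<oplus>\<^bsub>V\<^esub> z"]) (auto simp: V.M.a_assoc)
  then show "\<exists>G. finite G \<and> G \<subseteq> carrier W \<and> (\<forall>z\<in>perp_V G. x \<oplus>\<^bsub>V\<^esub> z \<in> (\<lambda>y. v \<oplus>\<^bsub>V\<^esub> y) ` perp_V F)"
    using F by blast
qed

text \<open>Cosets of \<open>perp_V F\<close> are open, and every neighbourhood of \<open>v\<close>
  contains one through \<open>v\<close>. As \<open>perp_V F\<close> is closed under negation, the
  condition says that \<open>v\<close> lies in the sum of \<open>X\<close> and
  \<open>perp_V F\<close> for every finite \<open>F\<close>.\<close>

lemma in_closure_of_weak:
  "v \<in> weak closure_of X \<longleftrightarrow> v \<in> carrier V \<and>
    (\<forall>F. finite F \<and> F \<subseteq> carrier W \<longrightarrow> (\<exists>y\<in>perp_V F. v \<oplus>\<^bsub>V\<^esub> y \<in> X))"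
  (is "_ \<longleftrightarrow> v \<in> carrier V \<and> ?N")
proof (cases "v \<in> carrier V")
  case v: True
  have "?N" if cl: "v \<in> weak closure_of X"
  proof (intro allI impI)
    fix F assume F: "finite F \<and> F \<subseteq> carrier W"
    have "\<zero>\<^bsub>V\<^esub> \<in> perp_V F"
      using F V.right_submoduleD(3)[OF right_submodule_perp_left] by blast
    then have "v \<in> (\<lambda>y. v \<oplus>\<^bsub>V\<^esub> y) ` perp_V F"
      using v by (intro image_eqI[of _ _ "\<zero>\<^bsub>V\<^esub>"]) auto
    then show "\<exists>y\<in>perp_V F. v \<oplus>\<^bsub>V\<^esub> y \<in> X"
      using cl openin_weak_coset[OF v, of F] F unfolding in_closure_of by blast
  qed
  moreover have "v \<in> weak closure_of X" if N: ?N
    unfolding in_closure_of topspace_weak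
  proof (intro conjI allI impI v)
    fix U assume "v \<in> U \<and> openin weak U"
    then obtain F where "finite F" "F \<subseteq> carrier W" "\<forall>y\<in>perp_V F. v \<oplus>\<^bsub>V\<^esub> y \<in> U"
      unfolding openin_weak_topology by blast
    then show "\<exists>y. y \<in> X \<and> y \<in> U" using N by blast
  qed
  ultimately show ?thesis using v by blast
next
  case False
  then show ?thesis by (simp add: in_closure_of topspace_weak)
qed

lemma closure_of_submodule:
  assumes R: "inj_cogenerator_ring R" and X: "right_submodule X R V"
  shows "weak closure_of X = perp_V (perp_W X)"
proof
  note XD = V.right_submoduleD[OF X]
  show "weak closure_of X \<subseteq> perp_V (perp_W X)"
  proof
    fix v assume cl: "v \<in> weak closure_of X"
    then have v: "v \<in> carrier V" by (simp add: in_closure_of_weak)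
    have "\<kappa> v w = \<zero>" if w: "w \<in> perp_W X" for w
    proof -
      have wW: "w \<in> carrier W" using w by (simp add: perp_right_def)
      \<comment> \<open>The finite set \<open>{w}\<close> suffices: adding \<open>y\<close> moves
        \<open>v\<close> into \<open>X\<close> without changing its value at
        \<open>w\<close>.\<close>
      then obtain y where y: "y \<in> perp_V {w}" "v \<oplus>\<^bsub>V\<^esub> y \<in> X"
        using cl unfolding in_closure_of_weak by (metis empty_subsetI finite.emptyI finite_insert insert_subset)
      then have "\<kappa> (v \<oplus>\<^bsub>V\<^esub> y) w = \<zero>" "\<kappa> y w = \<zero>" "y \<in> carrier V"
        using w by (auto simp: perp_right_def perp_left_def)
      then show ?thesis using kappa_simps[OF wW] v by simp
    qed
    then show "v \<in> perp_V (perp_W X)" using v by (simp add: perp_left_def)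
  qed
  show "perp_V (perp_W X) \<subseteq> weak closure_of X"
  proof
    fix v assume v: "v \<in> perp_V (perp_W X)"
    then have vV: "v \<in> carrier V" by (simp add: perp_left_def)
    have "\<exists>y\<in>perp_V F. v \<oplus>\<^bsub>V\<^esub> y \<in> X" if F: "finite F" "F \<subseteq> carrier W" for F
    proof (rule ccontr)
      assume no: "\<not> ?thesis"
      note FD = V.right_submoduleD[OF right_submodule_perp_left[OF F(2)]]
      \<comment> \<open>Containing \<open>perp_V F\<close> makes a functional that vanishes on
        \<open>N\<close> representable; containing \<open>X\<close> puts the representing element
        into \<open>perp_W X\<close>.\<close>
      define N where "N = {x \<oplus>\<^bsub>V\<^esub> y | x y. x \<in> X \<and> y \<in> perp_V F}"
      have NI: "x \<oplus>\<^bsub>V\<^esub> y \<in> N" if "x \<in> X" "y \<in> perp_V F" for x y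
        using that unfolding N_def by blast
      have N: "right_submodule N R V"
      proof (rule V.right_submoduleI)
        show "N \<subseteq> carrier V" using XD FD by (auto simp: N_def)
        show "\<zero>\<^bsub>V\<^esub> \<in> N" using NI[OF XD(3) FD(3)] by simp
      next
        fix p q assume "p \<in> N" "q \<in> N"
        then obtain x y x' y' where *: "x \<in> X" "y \<in> perp_V F" "p = x \<oplus>\<^bsub>V\<^esub> y"
          "x' \<in> X" "y' \<in> perp_V F" "q = x' \<oplus>\<^bsub>V\<^esub> y'" unfolding N_def by blast
        then have "p \<oplus>\<^bsub>V\<^esub> q = (x \<oplus>\<^bsub>V\<^esub> x') \<oplus>\<^bsub>V\<^esub> (y \<oplus>\<^bsub>V\<^esub> y')"
          using XD(2) FD(2) by (simp add: V.M.add.m_ac)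
        then show "p \<oplus>\<^bsub>V\<^esub> q \<in> N" using NI[of "x \<oplus>\<^bsub>V\<^esub> x'" "y \<oplus>\<^bsub>V\<^esub> y'"] * XD(4) FD(4) by simp
      next
        fix p a assume "p \<in> N" and a: "a \<in> carrier R"
        then obtain x y where *: "x \<in> X" "y \<in> perp_V F" "p = x \<oplus>\<^bsub>V\<^esub> y" unfolding N_def by blast
        then have "p \<cdot>\<^bsub>V\<^esub> a = x \<cdot>\<^bsub>V\<^esub> a \<oplus>\<^bsub>V\<^esub> y \<cdot>\<^bsub>V\<^esub> a"
          using XD(2) FD(2) a by (simp add: V.rsmult_l_distr)
        then show "p \<cdot>\<^bsub>V\<^esub> a \<in> N"
          using NI[of "x \<cdot>\<^bsub>V\<^esub> a" "y \<cdot>\<^bsub>V\<^esub> a"] * XD(7) FD(7) a by simp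
      qed
      have "v \<notin> N"
      proof
        assume "v \<in> N"
        then obtain x y where *: "x \<in> X" "y \<in> perp_V F" "v = x \<oplus>\<^bsub>V\<^esub> y" unfolding N_def by blast
        then have "v \<oplus>\<^bsub>V\<^esub> \<ominus>\<^bsub>V\<^esub> y = x" using XD(2) FD(2) by (simp add: V.M.a_assoc V.M.r_neg)
        then show False using no * FD(5) by metis
      qed
      then obtain h where h: "h \<in> right_hom R V (rreg R)" "\<And>u. u \<in> N \<Longrightarrow> h u = \<zero>" "h v \<noteq> \<zero>"
        using V.inj_cogenerator_separates[OF R N vV] by blast
      have hF: "h u = \<zero>" if "u \<in> perp_V F" for u
        using h(2) NI[OF XD(3) that] FD(2)[OF that] by simp
      have hX: "h u = \<zero>" if "u \<in> X" for u
        using h(2) NI[OF that FD(3)] XD(2)[OF that] by simp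
      have carW: "submodule (carrier W) R W" by (rule W.submoduleI) (auto simp: W.smult_closed)
      obtain w where w: "w \<in> carrier W" "\<And>u. u \<in> carrier V \<Longrightarrow> h u = \<kappa> u w"
        using represented_if_vanishes_on_finite_perp
          [OF inj_cogenerator_any_type(1)[OF R] F carW h(1) hF] by blast
      have "w \<in> perp_W X" using w hX XD(2) by (auto simp: perp_right_def)
      then have "h v = \<zero>" using w(2)[OF vV] v by (simp add: perp_left_def)
      then show False using h(3) by simp
    qed
    then show "v \<in> weak closure_of X" using vV by (auto simp: in_closure_of_weak)
  qed
qed

lemma closedin_weak_iff:
  assumes R: "inj_cogenerator_ring R" and X: "right_submodule X R V"
  shows "closedin weak X \<longleftrightarrow> perp_V (perp_W X) = X"
  unfolding closure_of_eq[symmetric] closure_of_submodule[OF R X] ..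

text \<open>Density says that \<open>Y\<close> lies in the closure \<open>perp_V (perp_W X)\<close>.
  By the Galois connection of the two orthogonals this is
  \<open>perp_W X \<subseteq> perp_W Y\<close>, and the other inclusion follows from
  \<open>X \<subseteq> Y\<close>.\<close>

lemma dense_in_weak_iff:
  assumes R: "inj_cogenerator_ring R" and X: "right_submodule X R V"
    and Y: "right_submodule Y R V" and XY: "X \<subseteq> Y"
  shows "dense_in weak X Y \<longleftrightarrow> perp_W X = perp_W Y"
proof -
  have "Y \<inter> X = X" using XY by blast
  then have "dense_in weak X Y \<longleftrightarrow> Y \<subseteq> perp_V (perp_W X)"
    using XY unfolding dense_in_def closure_of_subtopology
    by (auto simp: closure_of_submodule[OF R X])
  also have "\<dots> \<longleftrightarrow> perp_W X \<subseteq> perp_W Y"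
    using V.right_submoduleD(1)[OF Y] by (fastforce simp: perp_left_def perp_right_def)
  also have "\<dots> \<longleftrightarrow> perp_W X = perp_W Y"
    using XY by (auto simp: perp_right_def)
  finally show ?thesis .
qed

lemma perp_right_carrier:
  assumes inj: "inj_on (chi V \<kappa>) (carrier W)"
  shows "perp_W (carrier V) = {\<zero>\<^bsub>W\<^esub>}"
proof
  show "perp_W (carrier V) \<subseteq> {\<zero>\<^bsub>W\<^esub>}"
  proof
    fix w assume w: "w \<in> perp_W (carrier V)"
    then have "chi V \<kappa> w = chi V \<kappa> \<zero>\<^bsub>W\<^esub>"
      by (auto simp: chi_def perp_right_def kappa_left_hom)
    then show "w \<in> {\<zero>\<^bsub>W\<^esub>}" using inj w by (auto simp: inj_on_def perp_right_def)
  qed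
  show "{\<zero>\<^bsub>W\<^esub>} \<subseteq> perp_W (carrier V)" by (auto simp: perp_right_def kappa_left_hom)
qed

lemma closed_submodules_eq:
  assumes R: "inj_cogenerator_ring R"
  shows "{X. right_submodule X R V \<and> closedin weak X} = {perp_V K | K. submodule K R W}"
proof (intro equalityI subsetI)
  fix X assume "X \<in> {X. right_submodule X R V \<and> closedin weak X}"
  then have "submodule (perp_W X) R W" "X = perp_V (perp_W X)"
    using submodule_perp_right V.right_submoduleD(1) closedin_weak_iff[OF R] by auto
  then show "X \<in> {perp_V K | K. submodule K R W}" by blast
next
  fix X assume "X \<in> {perp_V K | K. submodule K R W}"
  then obtain K where K: "submodule K R W" "X = perp_V K" by blast
  note KW = W.submoduleD(1)[OF K(1)]
  \<comment> \<open>The Galois connection again: three orthogonals in a row equal one.\<close>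
  have "perp_V (perp_W (perp_V K)) = perp_V K" using KW by (auto simp: perp_left_def perp_right_def)
  then show "X \<in> {X. right_submodule X R V \<and> closedin weak X}"
    using right_submodule_perp_left[OF KW] closedin_weak_iff[OF R] K(2) by simp
qed

section \<open>Annihilators in the dual, and the results over QF rings\<close>

lemma mem_An_iff:
  "g \<in> An R V X \<longleftrightarrow> g \<in> right_hom R V (rreg R) \<and> g \<in> extensional (carrier V) \<and> (\<forall>x\<in>X. g x = \<zero>)"
  by (auto simp: An_def rdual_def)

text \<open>Elements of the dual are extensional, so a functional belongs to \<open>An\<close> only
  after restriction to the carrier.\<close>

lemma restrict_mem_An:
  assumes "h \<in> right_hom R V (rreg R)" "X \<subseteq> carrier V" "\<And>x. x \<in> X \<Longrightarrow> h x = \<zero>"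
  shows "restrict h (carrier V) \<in> An R V X"
  using assms by (auto simp: mem_An_iff right_hom_def V.rsmult_closed)

text \<open>If \<open>X\<close> is closed and cofinite, it is the orthogonal of a finite subset of
  \<open>perp_W X\<close>, so every functional that kills \<open>X\<close> is represented in
  \<open>perp_W X\<close>. Conversely, a functional that kills \<open>X\<close> but not
  \<open>v\<close> is then represented by an element of \<open>perp_W X\<close>, which keeps
  \<open>v\<close> out of the double orthogonal.\<close>

lemma closed_cofinite_iff:
  assumes R: "inj_cogenerator_ring R" and QF: "QF_ring R" and X: "cofinite_submodule R V X"
  shows "closedin weak X \<longleftrightarrow> An R V X = chi V \<kappa> ` perp_W X"
proof -
  have XR: "right_submodule X R V" using X by (simp add: cofinite_submodule_def)
  note XD = V.right_submoduleD[OF XR]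
  have K: "submodule (perp_W X) R W" by (rule submodule_perp_right[OF XD(1)])
  note inj = inj_cogenerator_any_type(1)[OF R]
  show ?thesis
    unfolding closedin_weak_iff[OF R XR]
  proof
    assume closed: "perp_V (perp_W X) = X"
    show "An R V X = chi V \<kappa> ` perp_W X"
    proof (intro equalityI subsetI)
      fix g assume "g \<in> chi V \<kappa> ` perp_W X"
      then obtain w where w: "w \<in> perp_W X" "g = restrict (\<lambda>v. \<kappa> v w) (carrier V)"
        by (auto simp: chi_def)
      then show "g \<in> An R V X"
        using restrict_mem_An[OF kappa_right_hom[of w] XD(1)] by (auto simp: perp_right_def)
    next
      fix g assume g: "g \<in> An R V X"
      obtain S where S: "finite S" "S \<subseteq> carrier V"
        "\<And>N. right_submodule N R V \<Longrightarrow> X \<union> S \<subseteq> N \<Longrightarrow> N = carrier V"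
        by (rule V.cofinite_submodule_generators[OF X]) blast
      have noeth: "right_noetherian R (rreg R)" using QF by (simp add: QF_ring_def)
      obtain F where F: "finite F" "F \<subseteq> perp_W X" "perp_V F = perp_V (perp_W X)"
        using finite_perp_eq_perp[OF inj noeth W.submoduleD(1)[OF K] S(1,2)] S(3) closed by metis
      obtain w where w: "w \<in> perp_W X" "\<And>v. v \<in> carrier V \<Longrightarrow> g v = \<kappa> v w"
      proof (rule represented_if_vanishes_on_finite_perp[OF inj F(1,2) K])
        show "g \<in> right_hom R V (rreg R)" using g by (simp add: mem_An_iff)
        show "g v = \<zero>" if "v \<in> perp_V F" for v
          using g that F(3) closed by (simp add: mem_An_iff)
      qed blast
      have "g = chi V \<kappa> w"
        using g w(2) by (auto simp: chi_def mem_An_iff intro: extensionalityI)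
      then show "g \<in> chi V \<kappa> ` perp_W X" using w(1) by blast
    qed
  next
    assume An: "An R V X = chi V \<kappa> ` perp_W X"
    have "v \<in> X" if v: "v \<in> perp_V (perp_W X)" for v
    proof (rule ccontr)
      assume "v \<notin> X"
      have vV: "v \<in> carrier V" using v by (simp add: perp_left_def)
      obtain h where h: "h \<in> right_hom R V (rreg R)" "\<And>x. x \<in> X \<Longrightarrow> h x = \<zero>" "h v \<noteq> \<zero>"
        using V.inj_cogenerator_separates[OF R XR vV \<open>v \<notin> X\<close>] by blast
      have "restrict h (carrier V) \<in> chi V \<kappa> ` perp_W X"
        using restrict_mem_An[OF h(1) XD(1) h(2)] An by simp
      then obtain w where w: "w \<in> perp_W X" "restrict h (carrier V) = chi V \<kappa> w" by blast
      have "h v = \<kappa> v w" using fun_cong[OF w(2), of v] vV by (simp add: chi_def)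
      then show False using h(3) v w(1) by (simp add: perp_left_def)
    qed
    moreover have "X \<subseteq> perp_V (perp_W X)" using XD(1) by (auto simp: perp_left_def perp_right_def)
    ultimately show "perp_V (perp_W X) = X" by blast
  qed
qed

text \<open>An open submodule \<open>X\<close> contains some \<open>perp_V F\<close> with
  \<open>F\<close> finite, so \<open>V\<close> is finitely generated modulo \<open>X\<close>. Since
  \<open>X\<close> is also closed, it is the orthogonal of a finite subset of
  \<open>perp_W X\<close>. Conversely, the orthogonal of a finite set is a basic neighbourhood of
  zero.\<close>

lemma open_submodules_eq:
  assumes R: "inj_cogenerator_ring R" and QF: "QF_ring R"
  shows "{X. right_submodule X R V \<and> openin weak X} = {perp_V K | K. submodule K R W \<and> left_fin_gen R W K}"
proof (intro equalityI subsetI)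
  fix X assume "X \<in> {perp_V K | K. submodule K R W \<and> left_fin_gen R W K}"
  then obtain F where F: "finite F" "F \<subseteq> carrier W" "X = perp_V F"
    using perp_left_left_span by (auto simp: left_fin_gen_def)
  have "openin weak ((\<lambda>y. \<zero>\<^bsub>V\<^esub> \<oplus>\<^bsub>V\<^esub> y) ` perp_V F)" by (rule openin_weak_coset) (use F in auto)
  moreover have "(\<lambda>y. \<zero>\<^bsub>V\<^esub> \<oplus>\<^bsub>V\<^esub> y) ` perp_V F = perp_V F"
    by (force simp: perp_left_def)
  ultimately show "X \<in> {X. right_submodule X R V \<and> openin weak X}"
    using F right_submodule_perp_left[OF F(2)] by simp
next
  fix X assume "X \<in> {X. right_submodule X R V \<and> openin weak X}"
  then have XR: "right_submodule X R V" and open_X: "openin weak X" by auto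
  note XD = V.right_submoduleD[OF XR]
  have noeth: "right_noetherian R (rreg R)" using QF by (simp add: QF_ring_def)
  obtain F where F: "finite F" "F \<subseteq> carrier W" "\<And>y. y \<in> perp_V F \<Longrightarrow> \<zero>\<^bsub>V\<^esub> \<oplus>\<^bsub>V\<^esub> y \<in> X"
    using open_X XD(3) unfolding openin_weak_topology by meson
  have FX: "perp_V F \<subseteq> X" using F(3) by (force simp: perp_left_def)
  have closed: "perp_V (perp_W X) = X"
  proof -
    have "v \<in> X" if cl: "v \<in> weak closure_of X" for v
    proof -
      have v: "v \<in> carrier V" using cl by (simp add: in_closure_of_weak)
      obtain y where y: "y \<in> perp_V F" "v \<oplus>\<^bsub>V\<^esub> y \<in> X"
        using cl F(1,2) unfolding in_closure_of_weak by blast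
      then have "(v \<oplus>\<^bsub>V\<^esub> y) \<ominus>\<^bsub>V\<^esub> y \<in> X" using FX XD(6) by blast
      then show ?thesis using v y(1) FX XD(2)[of y] by (auto simp: V.M.minus_eq V.M.a_assoc V.M.r_neg)
    qed
    moreover have "X \<subseteq> perp_V (perp_W X)" using XD(1) by (auto simp: perp_left_def perp_right_def)
    ultimately show ?thesis using closure_of_submodule[OF R XR] by blast
  qed
  obtain S where S: "finite S" "S \<subseteq> carrier V"
    "\<And>N. right_submodule N R V \<Longrightarrow> perp_V F \<union> S \<subseteq> N \<Longrightarrow> N = carrier V"
    by (rule finite_perp_generators[OF noeth F(1,2)]) blast
  have KW: "perp_W X \<subseteq> carrier W" by (auto simp: perp_right_def)
  \<comment> \<open>Generators of \<open>V\<close> modulo \<open>perp_V F\<close> also generate it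
    modulo the larger submodule \<open>X\<close>, which is \<open>perp_V (perp_W X)\<close>.\<close>
  obtain G where G: "finite G" "G \<subseteq> perp_W X" "perp_V G = perp_V (perp_W X)"
  proof (rule finite_perp_eq_perp[OF inj_cogenerator_any_type(1)[OF R] noeth KW S(1,2)])
    show "N = carrier V" if "right_submodule N R V" "perp_V (perp_W X) \<union> S \<subseteq> N" for N
      using S(3)[OF that(1)] that(2) closed FX by blast
  qed blast
  have GW: "G \<subseteq> carrier W" using G(2) KW by blast
  have "X = perp_V (left_span R W G)" using perp_left_left_span[OF GW] G(3) closed by simp
  moreover have "left_fin_gen R W (left_span R W G)" using G(1) GW by (auto simp: left_fin_gen_def)
  ultimately show "X \<in> {perp_V K | K. submodule K R W \<and> left_fin_gen R W K}"
    using W.submodule_left_span[OF GW] by blast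
qed

end

theorem theorem1p8:
  fixes R :: "('a, 'x) ring_scheme"
    and V :: "('a, 'v, 'y) rmodule_scheme"
    and W :: "('a, 'w, 'z) module_scheme"
    and \<kappa> :: "'v \<Rightarrow> 'w \<Rightarrow> 'a"
  assumes "ring R"
    and "\<one>\<^bsub>R\<^esub> \<noteq> \<zero>\<^bsub>R\<^esub>"
    and "inj_cogenerator_ring R"
    and "left_pairing R V W \<kappa>"
  defines "T \<equiv> weak_topology R V W \<kappa>"
  shows
    "(\<forall>X. right_submodule X R V \<longrightarrow>
        T closure_of X = perp_left R V \<kappa> (perp_right R W \<kappa> X))
     \<and>
     (\<forall>X Y. right_submodule X R V \<and> right_submodule Y R V \<and> X \<subseteq> Y \<longrightarrow>
        (dense_in T X Y \<longleftrightarrow> perp_right R W \<kappa> X = perp_right R W \<kappa> Y))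
     \<and>
     (inj_on (chi V \<kappa>) (carrier W) \<longrightarrow>
        (\<forall>X. right_submodule X R V \<longrightarrow>
          (dense_in T X (carrier V) \<longleftrightarrow> perp_right R W \<kappa> X = {\<zero>\<^bsub>W\<^esub>})))
     \<and>
     (QF_ring R \<longrightarrow>
        (\<forall>X. cofinite_submodule R V X \<longrightarrow>
          (closedin T X \<longleftrightarrow> An R V X = chi V \<kappa> ` perp_right R W \<kappa> X)))
     \<and>
     {X. right_submodule X R V \<and> closedin T X} = {perp_left R V \<kappa> K | K. submodule K R W}
     \<and>
     (QF_ring R \<and> inj_on (chi V \<kappa>) (carrier W) \<longrightarrow>
        {X. right_submodule X R V \<and> openin T X} =
        {perp_left R V \<kappa> K | K. submodule K R W \<and> left_fin_gen R W K})"
proof -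
  interpret left_pairing R V W \<kappa> by fact
  note R = \<open>inj_cogenerator_ring R\<close>
  show ?thesis
    unfolding T_def
  proof (intro conjI allI impI)
    fix X assume "right_submodule X R V"
    then show "weak closure_of X = perp_V (perp_W X)" by (rule closure_of_submodule[OF R])
  next
    fix X Y assume "right_submodule X R V \<and> right_submodule Y R V \<and> X \<subseteq> Y"
    then show "dense_in weak X Y \<longleftrightarrow> perp_W X = perp_W Y" by (simp add: dense_in_weak_iff[OF R])
  next
    fix X assume "inj_on (chi V \<kappa>) (carrier W)" and X: "right_submodule X R V"
    then show "dense_in weak X (carrier V) \<longleftrightarrow> perp_W X = {\<zero>\<^bsub>W\<^esub>}"
      using dense_in_weak_iff[OF R X V.right_submodule_carrier V.right_submoduleD(1)[OF X]]
      by (simp add: perp_right_carrier)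
  next
    fix X assume "QF_ring R" "cofinite_submodule R V X"
    then show "closedin weak X \<longleftrightarrow> An R V X = chi V \<kappa> ` perp_W X" by (rule closed_cofinite_iff[OF R])
  next
    show "{X. right_submodule X R V \<and> closedin weak X} = {perp_V K | K. submodule K R W}"
      by (rule closed_submodules_eq[OF R])
  next
    assume "QF_ring R \<and> inj_on (chi V \<kappa>) (carrier W)"
    then show "{X. right_submodule X R V \<and> openin weak X} =
        {perp_V K | K. submodule K R W \<and> left_fin_gen R W K}"
      by (intro open_submodules_eq[OF R]) simp
  qed
qed

end
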